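(* Consider the full-path-feedback game on a tree described in the context, with level bounds $R_1,\dots,R_L\in(0,1]$. Let the learner sample $A_t\sim p_t$ at each round $t\ge1$, where (follow-the-regularized-leader) $p_1=\arg\min_{p\in\Delta_K}\psi_1(p)$ and $p_{t}=\arg\min_{p\in\Delta_K}\big\langle\sum_{s\le t-1}z_s,p\big\rangle+\psi_{t}(p)$ for $t\ge2$, with $$\psi_t(p)=\sqrt{5\max\{t,20\}}\sum_{j=1}^L R_j\sum_{v\in V_j}\big(p[v]-\sqrt{p[v]}\big),\qquad z_t(a)=\sum_{v\in\mathcal V:\,v\preceq a}\mathbf 1\{v\preceq A_t\}\frac{\ell_t(v)}{p_t[v]} .$$ Let $K_{\mathrm{eff}}(R)=\big(\sum_{j=1}^L R_j\sqrt{|V_j|}\big)^2$. Then for every horizon $T\ge1$, $$\mathrm{Reg}_T\le 15\sqrt{K_{\mathrm{eff}}(R)}+4\sqrt{5\,K_{\mathrm{eff}}(R)\,T}.$$ Moreover, suppose there exists $\Delta\in\mathbb R_+^K$ with $|\{a\in\mathcal A:\Delta(a)=0\}|\le1$ such that $\mathrm{Reg}_T\ge\mathbb E\sum_{t=1}^T\Delta(A_t)$ holds for any algorithm. Put $$\Gamma(j,\Delta)=\sum_{v\in V_j:\ \min_{a\succeq v}\Delta(a)\ne0}\ \frac1{\min_{a\succeq v}\Delta(a)},\qquad K_{\mathrm{eff}}^{\mathrm{sto}}(R)=\Big(\sum_{j=1}^L R_j\sqrt{\Gamma(j,\Delta)}\Big)^2,$$ where $a\succeq v$ ranges over the leaves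 $a\in\mathcal A$ that are descendants of $v$. Then $$\mathrm{Reg}_T\le 30\sqrt{K_{\mathrm{eff}}(R)}+20\,K_{\mathrm{eff}}^{\mathrm{sto}}(R)\,\ln(eT).$$
   Context: Tree. $\mathcal A$ is a finite set of $K$ actions, the leaf set of a rooted tree of depth $L\ge1$ all of whose leaves are at depth $L$. $V_j$ is the set of nodes at depth $j$ ($V_0$ contains only the root, $V_L=\mathcal A$), and $\mathcal V=\bigcup_{j=1}^LV_j$ (root excluded). $v\preceq w$ (or $w\succeq v$) means $v$ is an ancestor of $w$; every node is its own ancestor. $\Delta_K$ is the simplex of probability vectors indexed by $\mathcal A$, and for $x\in\mathbb R^K$, $x[v]=\sum_{a\in\mathcal A:\,v\preceq a}x(a)$. Game. At each round $t$ the environment secretly draws $\ell_t:\mathcal V\to[0,1]$ with $\ell_t(v)\le R_j$ for all $v\in V_j$, $j\in\{1,\dots,L\}$; the loss of action $a$ is $y_t(a)=\sum_{v\in\mathcal V:\,v\preceq a}\ell_t(v)$. The learner plays $A_t\in\mathcal A$, suffers $y_t(A_t)$, and observes $\ell_t(v)$ for all $v\in\mathcal V$ with $v\preceq A_t$. The environment may react to the past: $\ell_t$ may depend on everything up to round $t-1$, but is independent of the learner's actions at round $t$ or later, conditionally on the events up to the end of round $t-1$. "$A_t\sim p_t$" means that the conditional law of $A_t$ given the past is $p_t$. The regret is $\mathrm{Reg}_T=\mathbb E\big[\sum_{t=1}^Ty_t(A_t)\big]-\min_{a\in\mathcal A}\mathbb E\big[\sum_{t=1}^Ty_t(a)\big]$.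 *)

theory Defs
  imports "HOL-Probability.Probability"
begin

section \<open>Rooted trees\<close>

text \<open>The root is its own parent, so that ancestors are exactly the iterates of the parent map.\<close>

record 'v rtree =
  verts :: "'v set"
  rt :: "'v"
  parent :: "'v \<Rightarrow> 'v"

definition rooted_tree :: "'v rtree \<Rightarrow> bool" where
  "rooted_tree G \<longleftrightarrow>
     finite (verts G) \<and> rt G \<in> verts G \<and> parent G (rt G) = rt G \<and>
     (\<forall>v\<in>verts G. parent G v \<in> verts G \<and> (\<exists>k. (parent G ^^ k) v = rt G))"

definition depth :: "'v rtree \<Rightarrow> 'v \<Rightarrow> nat" where
  "depth G v = (LEAST k. (parent G ^^ k) v = rt G)"

definition ancestor :: "'v rtree \<Rightarrow> 'v \<Rightarrow> 'v \<Rightarrow> bool" where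
  "ancestor G v w \<longleftrightarrow> (\<exists>k. (parent G ^^ k) w = v)"

definition leaves :: "'v rtree \<Rightarrow> 'v set" where
  "leaves G = {a \<in> verts G. \<forall>w \<in> verts G - {rt G}. parent G w \<noteq> a}"

definition level :: "'v rtree \<Rightarrow> nat \<Rightarrow> 'v set" where
  "level G j = {v \<in> verts G. depth G v = j}"

definition uniform_tree :: "'v rtree \<Rightarrow> nat \<Rightarrow> bool" where
  "uniform_tree G L \<longleftrightarrow> rooted_tree G \<and> 1 \<le> L \<and> (\<forall>a\<in>leaves G. depth G a = L)"

definition nonroot :: "'v rtree \<Rightarrow> 'v set" where
  "nonroot G = verts G - {rt G}"

definition path :: "'v rtree \<Rightarrow> 'v \<Rightarrow> 'v set" where
  "path G a = {v \<in> nonroot G. ancestor G v a}"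

definition leaves_below :: "'v rtree \<Rightarrow> 'v \<Rightarrow> 'v set" where
  "leaves_below G v = {a \<in> leaves G. ancestor G v a}"

definition mass :: "'v rtree \<Rightarrow> ('v \<Rightarrow> real) \<Rightarrow> 'v \<Rightarrow> real" where
  "mass G x v = (\<Sum>a\<in>leaves_below G v. x a)"

text \<open>Vectors indexed by the actions are functions on all nodes; only their values on the leaves
  are ever used.\<close>

definition prob_simplex :: "'v rtree \<Rightarrow> ('v \<Rightarrow> real) set" where
  "prob_simplex G = {p. (\<forall>a\<in>leaves G. 0 \<le> p a) \<and> (\<Sum>a\<in>leaves G. p a) = 1}"


section \<open>The game\<close>

text \<open>
  Rounds are numbered from 0: coordinate \<open>n\<close> of a history is what happens in round \<open>n + 1\<close> of the
  usual numbering, namely the pair of the loss function drawn by the environment and the action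
  played. A history of the first \<open>n\<close> rounds is an element of the product over \<open>{0..<n}\<close>.
\<close>

type_synonym 'v round = "('v \<Rightarrow> real) \<times> 'v"
type_synonym 'v history = "nat \<Rightarrow> 'v round"
type_synonym 'v env = "nat \<Rightarrow> 'v history \<Rightarrow> ('v \<Rightarrow> real) measure"
type_synonym 'v strategy = "nat \<Rightarrow> 'v history \<Rightarrow> 'v \<Rightarrow> real"

definition loss_space :: "'v rtree \<Rightarrow> (nat \<Rightarrow> real) \<Rightarrow> ('v \<Rightarrow> real) measure" where
  "loss_space G R =
     (\<Pi>\<^sub>M v\<in>nonroot G. restrict_space borel {x. 0 \<le> x \<and> x \<le> 1 \<and> x \<le> R (depth G v)})"

definition round_space :: "'v rtree \<Rightarrow> (nat \<Rightarrow> real) \<Rightarrow> 'v round measure" where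
  "round_space G R = loss_space G R \<Otimes>\<^sub>M count_space (leaves G)"

definition history_space :: "'v rtree \<Rightarrow> (nat \<Rightarrow> real) \<Rightarrow> nat \<Rightarrow> 'v history measure" where
  "history_space G R n = (\<Pi>\<^sub>M s\<in>{0..<n}. round_space G R)"

definition action_loss :: "'v rtree \<Rightarrow> ('v \<Rightarrow> real) \<Rightarrow> 'v \<Rightarrow> real" where
  "action_loss G l a = (\<Sum>v\<in>path G a. l v)"

definition environment :: "'v rtree \<Rightarrow> (nat \<Rightarrow> real) \<Rightarrow> 'v env \<Rightarrow> bool" where
  "environment G R env \<longleftrightarrow>
     (\<forall>n. env n \<in> history_space G R n \<rightarrow>\<^sub>M prob_algebra (loss_space G R))"

definition observe :: "'v rtree \<Rightarrow> 'v round \<Rightarrow> ('v \<Rightarrow> real) \<times> 'v" where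
  "observe G r = (restrict (fst r) (path G (snd r)), snd r)"

text \<open>
  A learning algorithm: a measurable choice of a distribution over actions that depends on the
  history only through the actions played and the losses observed on their root-to-leaf paths.
\<close>

definition learner :: "'v rtree \<Rightarrow> (nat \<Rightarrow> real) \<Rightarrow> 'v strategy \<Rightarrow> bool" where
  "learner G R p \<longleftrightarrow>
     (\<forall>n. (\<forall>h\<in>space (history_space G R n). p n h \<in> prob_simplex G) \<and>
          (\<forall>a\<in>leaves G. (\<lambda>h. p n h a) \<in> borel_measurable (history_space G R n)) \<and>
          (\<forall>h\<in>space (history_space G R n). \<forall>h'\<in>space (history_space G R n).
             (\<forall>s<n. observe G (h s) = observe G (h' s)) \<longrightarrow> (\<forall>a\<in>leaves G. p n h a = p n h' a)))"

text \<open>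
  Given the past, the loss function and the action of a round are independent: this is the product
  measure below. The law of the first \<open>T\<close> rounds is composed from these kernels by the
  finite-horizon kernel \<open>C\<close> of the Ionescu-Tulcea construction.
\<close>

definition round_law :: "'v rtree \<Rightarrow> 'v env \<Rightarrow> 'v strategy \<Rightarrow> nat \<Rightarrow> 'v history \<Rightarrow> 'v round measure"
  where
  "round_law G env p n h =
     env n h \<Otimes>\<^sub>M point_measure (leaves G) (\<lambda>a. ennreal (p n h a))"

definition play ::
  "'v rtree \<Rightarrow> (nat \<Rightarrow> real) \<Rightarrow> 'v env \<Rightarrow> 'v strategy \<Rightarrow> nat \<Rightarrow> 'v history measure" where
  "play G R env p T =
     Ionescu_Tulcea.C (round_law G env p) (\<lambda>_. round_space G R) 0 T (\<lambda>_. undefined)"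

definition regret ::
  "'v rtree \<Rightarrow> (nat \<Rightarrow> real) \<Rightarrow> 'v env \<Rightarrow> 'v strategy \<Rightarrow> nat \<Rightarrow> real" where
  "regret G R env p T =
     (\<integral>h. (\<Sum>t<T. action_loss G (fst (h t)) (snd (h t))) \<partial>play G R env p T) -
     Min ((\<lambda>a. \<integral>h. (\<Sum>t<T. action_loss G (fst (h t)) a) \<partial>play G R env p T) ` leaves G)"


section \<open>Follow the regularized leader\<close>

definition psi :: "'v rtree \<Rightarrow> nat \<Rightarrow> (nat \<Rightarrow> real) \<Rightarrow> nat \<Rightarrow> ('v \<Rightarrow> real) \<Rightarrow> real" where
  "psi G L R t p =
     sqrt (5 * real (max t 20)) *
       (\<Sum>j=1..L. R j * (\<Sum>v\<in>level G j. mass G p v - sqrt (mass G p v)))"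

definition loss_estimate :: "'v rtree \<Rightarrow> ('v \<Rightarrow> real) \<Rightarrow> 'v round \<Rightarrow> 'v \<Rightarrow> real" where
  "loss_estimate G p r a =
     (\<Sum>v\<in>path G a. of_bool (ancestor G v (snd r)) * (fst r v / mass G p v))"

text \<open>Because of the shift of the round numbers, coordinate \<open>n\<close> uses the regularizer with index
  \<open>n + 1\<close>.\<close>

definition ftrl :: "'v rtree \<Rightarrow> nat \<Rightarrow> (nat \<Rightarrow> real) \<Rightarrow> 'v strategy \<Rightarrow> bool" where
  "ftrl G L R p \<longleftrightarrow>
     (\<forall>n. \<forall>h\<in>space (history_space G R n).
        is_arg_min
          (\<lambda>q. (\<Sum>a\<in>leaves G. (\<Sum>s<n. loss_estimate G (p s (restrict h {0..<s})) (h s) a) * q a)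
                + psi G L R (n + 1) q)
          (\<lambda>q. q \<in> prob_simplex G)
          (p n h))"


section \<open>Effective numbers of actions\<close>

definition K_eff :: "'v rtree \<Rightarrow> nat \<Rightarrow> (nat \<Rightarrow> real) \<Rightarrow> real" where
  "K_eff G L R = (\<Sum>j=1..L. R j * sqrt (real (card (level G j))))\<^sup>2"

definition Gam :: "'v rtree \<Rightarrow> nat \<Rightarrow> ('v \<Rightarrow> real) \<Rightarrow> real" where
  "Gam G j \<Delta> =
     (\<Sum>v\<in>{v \<in> level G j. Min (\<Delta> ` leaves_below G v) \<noteq> 0}. 1 / Min (\<Delta> ` leaves_below G v))"

definition K_eff_sto :: "'v rtree \<Rightarrow> nat \<Rightarrow> (nat \<Rightarrow> real) \<Rightarrow> ('v \<Rightarrow> real) \<Rightarrow> real" where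
  "K_eff_sto G L R \<Delta> = (\<Sum>j=1..L. R j * sqrt (Gam G j \<Delta>))\<^sup>2"

end

theory Submission
  imports Defs
begin

text \<open>The constants 5 and 20 of the regularizer come from the stability estimate. A centered
  estimate has no useful upper bound, but it is at least \<open>- weight v\<close>. Once the rate is
  at least 10, such a negative value destroys at most one fifth of the curvature of the regularizer
  at a node, and this produces the factor \<open>5/2\<close>. The plateau \<open>max t 20\<close>
  enforces exactly this, since \<open>sqrt (5 * 20) = 10\<close>. With rate
  \<open>c * sqrt t\<close>, stability costs about \<open>5 / (2 * c * sqrt t)\<close> per round and
  the growth of the rate about \<open>c / (2 * sqrt t)\<close>; they balance at
  \<open>c = sqrt 5\<close>. The factor \<open>1 - m\<close> gained by centering is indispensable in
  the stochastic case: the node of gap zero may have mass close to one, and only this factor bounds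
  its share by the masses of the other nodes. The strategy is given solely as a minimizer, so its
  measurability and its dependence on observations alone have to be derived. Both follow from
  quadratic growth of the objective around its minimizer, which makes the minimizer a Hoelder
  function of the cumulative estimates.\<close>

text \<open>
  On the simplex the regularizer is, up to a constant, minus the sum over the nodes of the weighted
  square roots of their masses, so its Bregman divergence at the minimizer splits over the nodes,
  and so does the pairing with the loss estimates. Moreover the masses of a level sum to one, hence
  the loss of the played node of a level may be subtracted from the estimates on that level. With
  this centering the expected stability term of a node of mass \<open>m\<close> and weight \<open>w\<close> is at most
  \<open>5/2 * w * sqrt m * (1 - m) / rate\<close>. By Cauchy-Schwarz on the levels this gives the adversarial
  bound. In the stochastic case at most one node per level has gap zero and it can be dropped from
  all sums; the rest is at most \<open>sto_width * sqrt D\<close> with \<open>D\<close> the expected gap of the round, and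
  bounding the regret \<open>Reg\<close> as \<open>2 * Reg - Reg\<close> absorbs \<open>D\<close>.
\<close>

section \<open>Levels and paths of a uniform tree\<close>

locale level_tree =
  fixes G :: "'v rtree" and L :: nat
  assumes tree: "uniform_tree G L"
begin

lemma finite_verts [simp]: "finite (verts G)"
  and rt_in_verts [simp]: "rt G \<in> verts G"
  and parent_rt [simp]: "parent G (rt G) = rt G"
  and parent_in_verts: "v \<in> verts G \<Longrightarrow> parent G v \<in> verts G"
  and reaches_rt: "v \<in> verts G \<Longrightarrow> \<exists>k. (parent G ^^ k) v = rt G"
  and one_le_L: "1 \<le> L"
  and depth_leaf: "a \<in> leaves G \<Longrightarrow> depth G a = L"
  using tree by (auto simp: uniform_tree_def rooted_tree_def)

lemma finite_leaves [simp]: "finite (leaves G)"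
  and finite_level [simp]: "finite (level G j)"
  and finite_nonroot [simp]: "finite (nonroot G)"
  and finite_leaves_below [simp]: "finite (leaves_below G v)"
  and finite_path [simp]: "finite (path G a)"
  by (auto simp: leaves_def level_def nonroot_def leaves_below_def path_def)

lemma leaf_in_verts: "a \<in> leaves G \<Longrightarrow> a \<in> verts G"
  by (simp add: leaves_def)

lemma funpow_parent_in_verts: "v \<in> verts G \<Longrightarrow> (parent G ^^ k) v \<in> verts G"
  by (induction k) (auto intro: parent_in_verts)

lemma funpow_depth: "v \<in> verts G \<Longrightarrow> (parent G ^^ depth G v) v = rt G"
  unfolding depth_def using reaches_rt by (rule LeastI_ex)

lemma depth_eq_0_iff: "v \<in> verts G \<Longrightarrow> depth G v = 0 \<longleftrightarrow> v = rt G"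
  using funpow_depth[of v] by (auto simp: depth_def)

lemma depth_parent:
  assumes "v \<in> verts G"
  shows "depth G (parent G v) = depth G v - 1"
proof (cases "v = rt G")
  case True
  then show ?thesis using depth_eq_0_iff[of "rt G"] by simp
next
  case False
  obtain k where "(parent G ^^ k) v = rt G"
    using reaches_rt[OF assms] by blast
  from Least_Suc[of "\<lambda>k. (parent G ^^ k) v = rt G", OF this] False show ?thesis
    by (simp add: depth_def funpow_swap1)
qed

lemma depth_funpow_parent: "v \<in> verts G \<Longrightarrow> depth G ((parent G ^^ k) v) = depth G v - k"
  by (induction k) (auto simp: depth_parent funpow_parent_in_verts)

text \<open>A deepest descendant of \<open>v\<close> cannot have a child, so it is a leaf. Minima
  over \<open>leaves_below\<close> and the positivity of masses rest on this.\<close>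

lemma leaves_below_nonempty:
  assumes v: "v \<in> verts G"
  shows "leaves_below G v \<noteq> {}"
proof -
  let ?D = "{w \<in> verts G. ancestor G v w}"
  have "ancestor G v v"
    unfolding ancestor_def by (rule exI[of _ 0]) simp
  with v have "v \<in> ?D" by simp
  then have "Max (depth G ` ?D) \<in> depth G ` ?D" by (intro Max_in) auto
  then obtain w where w: "w \<in> ?D" and "depth G w = Max (depth G ` ?D)" by auto
  then have max: "depth G u \<le> depth G w" if "u \<in> ?D" for u
    using that by (auto intro!: Max_ge)
  have "w \<in> leaves G"
    unfolding leaves_def
  proof (intro CollectI conjI ballI notI)
    show "w \<in> verts G" using w by simp
    fix u assume u: "u \<in> verts G - {rt G}" and uw: "parent G u = w"
    obtain k where "(parent G ^^ k) w = v" using w by (auto simp: ancestor_def)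
    with uw have "(parent G ^^ Suc k) u = v" by (simp add: funpow_swap1)
    then have "u \<in> ?D" using u by (auto simp: ancestor_def simp del: funpow.simps)
    moreover have "depth G u = Suc (depth G w)"
      using u uw depth_parent[of u] depth_eq_0_iff[of u] by auto
    ultimately show False using max[of u] by simp
  qed
  with w show ?thesis by (auto simp: leaves_below_def)
qed

lemma leaves_nonempty: "leaves G \<noteq> {}"
  using leaves_below_nonempty[OF rt_in_verts] by (auto simp: leaves_below_def)

text \<open>Meaningful only for leaves \<open>a\<close>, which have depth \<open>L\<close>.\<close>

definition proj :: "nat \<Rightarrow> 'v \<Rightarrow> 'v" where
  "proj j a = (parent G ^^ (L - j)) a"

text \<open>All leaves have depth \<open>L\<close>, so the number of parent steps to an ancestor is
  determined by its depth. Ancestry of leaves thus becomes membership in fibres of the maps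
  \<open>proj j\<close>.\<close>

lemma ancestor_leaf_iff:
  assumes a: "a \<in> leaves G" and v: "v \<in> verts G"
  shows "ancestor G v a \<longleftrightarrow> proj (depth G v) a = v"
proof
  assume "ancestor G v a"
  then obtain k where k: "(parent G ^^ k) a = v" by (auto simp: ancestor_def)
  then have d: "depth G v = L - k"
    using depth_funpow_parent[OF leaf_in_verts[OF a], of k] depth_leaf[OF a] by simp
  show "proj (depth G v) a = v"
  proof (cases "k \<le> L")
    case True
    with d k show ?thesis by (simp add: proj_def)
  next
    \<comment> \<open>More than \<open>L\<close> parent steps overshoot: \<open>L - k\<close> is
      truncated to 0, so \<open>v\<close> is the root, where the parent map stays.\<close>
    case False
    with d v have "v = rt G" using depth_eq_0_iff by auto
    with False d show ?thesis
      using funpow_depth[OF leaf_in_verts[OF a]] depth_leaf[OF a] by (simp add: proj_def)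
  qed
qed (auto simp: ancestor_def proj_def)

lemma proj_in_level:
  assumes "a \<in> leaves G" "j \<le> L"
  shows "proj j a \<in> level G j"
  using assms depth_funpow_parent[OF leaf_in_verts, of a "L - j"] depth_leaf[of a]
  by (auto simp: level_def proj_def funpow_parent_in_verts leaf_in_verts)

lemma depth_le_L:
  assumes v: "v \<in> verts G"
  shows "depth G v \<le> L"
proof -
  obtain a k where "a \<in> leaves G" "(parent G ^^ k) a = v"
    using leaves_below_nonempty[OF v] by (auto simp: leaves_below_def ancestor_def)
  then show ?thesis
    using depth_funpow_parent[of a k] depth_leaf[of a] leaf_in_verts by auto
qed

lemma leaves_below_eq: "v \<in> level G j \<Longrightarrow> leaves_below G v = {a \<in> leaves G. proj j a = v}"
  by (auto simp: leaves_below_def ancestor_leaf_iff level_def)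

lemma depth_nonroot: "v \<in> nonroot G \<Longrightarrow> depth G v \<in> {1..L}"
  using depth_le_L[of v] depth_eq_0_iff[of v] by (auto simp: nonroot_def Suc_le_eq)

lemma level_subset_nonroot: "1 \<le> j \<Longrightarrow> level G j \<subseteq> nonroot G"
  using depth_eq_0_iff[of "rt G"] by (auto simp: level_def nonroot_def)

lemma sum_nonroot: "(\<Sum>v\<in>nonroot G. f v) = (\<Sum>j=1..L. \<Sum>v\<in>level G j. f v)"
proof -
  have "(\<Sum>v\<in>nonroot G. f v) = (\<Sum>j=1..L. \<Sum>v\<in>{v \<in> nonroot G. depth G v = j}. f v)"
    by (rule sum.group[symmetric]) (use depth_nonroot in auto)
  also have "\<dots> = (\<Sum>j=1..L. \<Sum>v\<in>level G j. f v)"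
    using level_subset_nonroot by (intro sum.cong) (auto simp: level_def nonroot_def)
  finally show ?thesis .
qed

text \<open>The leaves below the nodes of a level are the fibres of \<open>proj j\<close>, hence a
  partition of all leaves.\<close>

lemma sum_level_mass: "j \<le> L \<Longrightarrow> (\<Sum>v\<in>level G j. mass G x v) = (\<Sum>a\<in>leaves G. x a)"
  unfolding mass_def
  by (subst sum.group[of "leaves G" "level G j" "proj j" x, symmetric])
     (auto simp: proj_in_level leaves_below_eq intro!: sum.cong)

text \<open>A node of depth \<open>L\<close> has a leaf below it, and projecting that leaf to depth
  \<open>L\<close> takes no parent step.\<close>

lemma level_L: "level G L = leaves G"
proof (intro equalityI subsetI)
  fix v assume v: "v \<in> level G L"
  then obtain a where "a \<in> leaves G" "proj L a = v"
    using leaves_below_nonempty[of v] leaves_below_eq[OF v] by (auto simp: level_def)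
  then show "v \<in> leaves G" by (simp add: proj_def)
qed (auto simp: level_def leaf_in_verts depth_leaf)

lemma leaf_in_nonroot: "a \<in> leaves G \<Longrightarrow> a \<in> nonroot G"
  using level_subset_nonroot[OF one_le_L] by (auto simp: level_L)

lemma mass_leaf: "a \<in> leaves G \<Longrightarrow> mass G x a = x a"
proof -
  assume a: "a \<in> leaves G"
  then have "leaves_below G a = {a}"
    by (subst leaves_below_eq[of a L]) (auto simp: level_L proj_def)
  then show ?thesis by (simp add: mass_def)
qed

lemma sum_path_eq: "(\<Sum>v\<in>path G a. f v) = (\<Sum>v\<in>nonroot G. of_bool (ancestor G v a) * f v)"
  for f :: "'v \<Rightarrow> real"
  unfolding path_def by (subst sum.inter_filter, simp) (intro sum.cong refl, simp)

lemma mass_eq: "mass G x v = (\<Sum>a\<in>leaves G. of_bool (ancestor G v a) * x a)"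
  unfolding mass_def leaves_below_def
  by (subst sum.inter_filter, simp) (intro sum.cong refl, simp)

text \<open>Summation along paths and summation over subtrees are adjoint. This is what splits the
  pairing of loss estimates with a distribution over the nodes.\<close>

lemma sum_path_mult: "(\<Sum>a\<in>leaves G. (\<Sum>v\<in>path G a. f v) * q a) = (\<Sum>v\<in>nonroot G. f v * mass G q v)"
proof -
  have "(\<Sum>a\<in>leaves G. (\<Sum>v\<in>path G a. f v) * q a)
      = (\<Sum>a\<in>leaves G. \<Sum>v\<in>nonroot G. of_bool (ancestor G v a) * f v * q a)"
    by (simp only: sum_path_eq sum_distrib_right)
  also have "\<dots> = (\<Sum>v\<in>nonroot G. \<Sum>a\<in>leaves G. of_bool (ancestor G v a) * f v * q a)"
    by (rule sum.swap)
  also have "\<dots> = (\<Sum>v\<in>nonroot G. f v * mass G q v)"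
    unfolding mass_eq sum_distrib_left by (intro sum.cong refl) (simp only: mult_ac)
  finally show ?thesis .
qed

lemma sum_path_proj:
  fixes f :: "'v \<Rightarrow> real"
  assumes a: "a \<in> leaves G"
  shows "(\<Sum>v\<in>path G a. f v) = (\<Sum>j=1..L. f (proj j a))"
proof -
  have "(\<Sum>v\<in>level G j. of_bool (ancestor G v a) * f v) = f (proj j a)" if "j \<in> {1..L}" for j
  proof -
    have "(\<Sum>v\<in>level G j. of_bool (ancestor G v a) * f v) = (\<Sum>v\<in>level G j. if proj j a = v then f v else 0)"
      using a by (intro sum.cong) (auto simp: level_def ancestor_leaf_iff)
    with that proj_in_level[OF a] show ?thesis by simp
  qed
  then show ?thesis unfolding sum_path_eq sum_nonroot by simp
qed

end

section \<open>Minimizers of the regularized objective\<close>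

text \<open>In terms of \<open>u = sqrt q - sqrt x\<close> the left-hand side is \<open>2 * sqrt q *
  \<zeta> * u - (\<zeta> + c / (2 * sqrt q)) * u\<^sup>2\<close>. The lower bound on \<zeta> keeps
  the quadratic coefficient above \<open>2 * c / (5 * sqrt q)\<close>, and maximizing over
  \<open>u\<close> gives the constant \<open>5/2\<close>.\<close>

lemma stability_scalar:
  fixes \<zeta> q x c :: real
  assumes q: "0 < q" and x: "0 \<le> x" and c: "0 < c" and \<zeta>: "- c \<le> 10 * sqrt q * \<zeta>"
  shows "\<zeta> * (q - x) - c * ((sqrt x - sqrt q)\<^sup>2 / (2 * sqrt q)) \<le> 5 / 2 * (q * sqrt q * \<zeta>\<^sup>2 / c)"
proof -
  define r where "r = sqrt q"
  define s where "s = sqrt x"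
  have r: "0 < r" "q = r\<^sup>2" and s: "0 \<le> s" "x = s\<^sup>2" using q x by (auto simp: r_def s_def)
  define X where "X = 5 / 2 * (r ^ 3 * \<zeta>\<^sup>2 / c) - (\<zeta> * (r\<^sup>2 - s\<^sup>2) - c * ((s - r)\<^sup>2 / (2 * r)))"
  have "0 \<le> c + 10 * r * \<zeta>" using \<zeta> by (simp add: r_def)
  then have "0 \<le> (r - s)\<^sup>2 * c * (c + 10 * r * \<zeta>)"
    by (rule mult_nonneg_nonneg[rotated]) (use c in simp)
  \<comment> \<open>A completed square plus a remainder whose sign is the hypothesis on \<zeta>; the
    sum is \<open>X\<close> with its denominators cleared.\<close>
  then have "0 \<le> (5 * r\<^sup>2 * \<zeta> - 2 * c * (r - s))\<^sup>2 + (r - s)\<^sup>2 * c * (c + 10 * r * \<zeta>)"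
    by (rule add_nonneg_nonneg[rotated]) simp
  also have "\<dots> = 10 * r * c * X"
    using r c by (simp add: X_def field_simps power2_eq_square power3_eq_cube)
  finally have "0 \<le> X"
    using r c mult_le_cancel_left_pos[of "10 * r * c" 0 X] by simp
  then have "\<zeta> * (r\<^sup>2 - s\<^sup>2) - c * ((s - r)\<^sup>2 / (2 * r)) \<le> 5 / 2 * (r ^ 3 * \<zeta>\<^sup>2 / c)"
    by (simp only: X_def diff_ge_0_iff_ge)
  with r s show ?thesis
    by (simp add: power2_eq_square power3_eq_cube real_sqrt_mult)
qed

text \<open>The case \<open>x = y = 0\<close> holds by division by zero. It matters because masses
  may vanish until minimizers are known to be positive.\<close>

lemma sqrt_diff_eq:
  assumes "0 \<le> x" "0 \<le> y"
  shows "sqrt x - sqrt y = (x - y) / (sqrt x + sqrt y)"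
proof (cases "sqrt x + sqrt y = 0")
  case True
  then have "sqrt x = 0 \<and> sqrt y = 0" using assms by (smt (verit) real_sqrt_ge_zero)
  then show ?thesis by simp
next
  case False
  have "(sqrt x - sqrt y) * (sqrt x + sqrt y) = x - y"
    using assms by (simp add: algebra_simps)
  with False show ?thesis by (simp add: field_simps)
qed

locale weighted_tree = level_tree G L for G :: "'v rtree" and L :: nat +
  fixes R :: "nat \<Rightarrow> real"
  assumes R_pos: "1 \<le> j \<Longrightarrow> j \<le> L \<Longrightarrow> 0 < R j"
begin

definition weight :: "'v \<Rightarrow> real" where
  "weight v = R (depth G v)"

definition ent :: "('v \<Rightarrow> real) \<Rightarrow> real" where
  "ent q = (\<Sum>v\<in>nonroot G. weight v * sqrt (mass G q v))"

definition pairing :: "('v \<Rightarrow> real) \<Rightarrow> ('v \<Rightarrow> real) \<Rightarrow> real" where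
  "pairing Z q = (\<Sum>a\<in>leaves G. Z a * q a)"

definition obj :: "('v \<Rightarrow> real) \<Rightarrow> real \<Rightarrow> ('v \<Rightarrow> real) \<Rightarrow> real" where
  "obj Z b q = pairing Z q - b * ent q"

definition minimizer :: "('v \<Rightarrow> real) \<Rightarrow> real \<Rightarrow> ('v \<Rightarrow> real) \<Rightarrow> bool" where
  "minimizer Z b p \<longleftrightarrow> p \<in> prob_simplex G \<and> (\<forall>q\<in>prob_simplex G. obj Z b p \<le> obj Z b q)"

lemma weight_pos: "v \<in> nonroot G \<Longrightarrow> 0 < weight v"
  using depth_nonroot R_pos by (auto simp: weight_def)

lemma weight_level: "v \<in> level G j \<Longrightarrow> weight v = R j"
  by (simp add: weight_def level_def)

lemma simplex_nonneg: "q \<in> prob_simplex G \<Longrightarrow> a \<in> leaves G \<Longrightarrow> 0 \<le> q a"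
  and simplex_sum: "q \<in> prob_simplex G \<Longrightarrow> (\<Sum>a\<in>leaves G. q a) = 1"
  by (auto simp: prob_simplex_def)

lemma mass_nonneg: "q \<in> prob_simplex G \<Longrightarrow> 0 \<le> mass G q v"
  unfolding mass_def by (intro sum_nonneg) (auto simp: simplex_nonneg leaves_below_def)

lemma mass_le_1:
  assumes "q \<in> prob_simplex G"
  shows "mass G q v \<le> 1"
proof -
  have "mass G q v \<le> (\<Sum>a\<in>leaves G. q a)"
    unfolding mass_def using assms by (intro sum_mono2) (auto simp: leaves_below_def simplex_nonneg)
  then show ?thesis using assms by (simp add: simplex_sum)
qed

lemma simplex_le_1: "q \<in> prob_simplex G \<Longrightarrow> a \<in> leaves G \<Longrightarrow> q a \<le> 1"
  using mass_le_1[of q a] by (simp add: mass_leaf)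

lemma mass_pos:
  assumes "\<And>a. a \<in> leaves G \<Longrightarrow> 0 < p a" "v \<in> verts G"
  shows "0 < mass G p v"
  unfolding mass_def using assms leaves_below_nonempty
  by (intro sum_pos) (auto simp: leaves_below_def)

lemma sum_level_simplex: "q \<in> prob_simplex G \<Longrightarrow> j \<le> L \<Longrightarrow> (\<Sum>v\<in>level G j. mass G q v) = 1"
  by (simp add: sum_level_mass simplex_sum)

lemma mass_affine: "mass G (\<lambda>a. p a + e * (q a - p a)) v = mass G p v + e * (mass G q v - mass G p v)"
  by (simp add: mass_def sum.distrib sum_distrib_left sum_subtractf right_diff_distrib)

lemma simplex_affine:
  assumes "p \<in> prob_simplex G" "q \<in> prob_simplex G" "0 \<le> e" "e \<le> 1"
  shows "(\<lambda>a. p a + e * (q a - p a)) \<in> prob_simplex G"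
proof -
  have "0 \<le> p a + e * (q a - p a)" if "a \<in> leaves G" for a
  proof -
    have "0 \<le> (1 - e) * p a + e * q a"
      using assms that by (intro add_nonneg_nonneg mult_nonneg_nonneg) (auto simp: simplex_nonneg)
    then show ?thesis by (simp add: algebra_simps)
  qed
  moreover have "(\<Sum>a\<in>leaves G. p a + e * (q a - p a)) = 1"
    using assms by (simp add: sum.distrib sum_subtractf simplex_sum flip: sum_distrib_left)
  ultimately show ?thesis by (simp add: prob_simplex_def)
qed

lemma pairing_affine: "pairing Z (\<lambda>a. p a + e * (q a - p a)) = pairing Z p + e * (pairing Z q - pairing Z p)"
  by (simp add: pairing_def sum.distrib sum_distrib_left sum_subtractf algebra_simps)

lemma minimizer_simplex: "minimizer Z b p \<Longrightarrow> p \<in> prob_simplex G"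
  by (simp add: minimizer_def)

text \<open>Optimality along the segment from the minimizer to \<open>q\<close>, divided by the step length \<open>e\<close>.\<close>

lemma minimizer_segment:
  assumes p: "minimizer Z b p" and q: "q \<in> prob_simplex G" and e: "0 < e" "e \<le> 1"
  shows "b * (\<Sum>v\<in>nonroot G. weight v * ((mass G q v - mass G p v) /
            (sqrt (mass G p v + e * (mass G q v - mass G p v)) + sqrt (mass G p v))))
         \<le> pairing Z q - pairing Z p"
    (is "b * ?S \<le> _")
proof -
  let ?pe = "\<lambda>a. p a + e * (q a - p a)"
  have ps: "p \<in> prob_simplex G" using p by (rule minimizer_simplex)
  have pe: "?pe \<in> prob_simplex G" using ps q e by (intro simplex_affine) auto
  have "ent ?pe - ent p = (\<Sum>v\<in>nonroot G. weight v * (sqrt (mass G ?pe v) - sqrt (mass G p v)))"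
    by (simp add: ent_def sum_subtractf right_diff_distrib)
  also have "\<dots> = e * ?S"
    unfolding sum_distrib_left
    using mass_nonneg[OF pe] mass_nonneg[OF ps]
    by (intro sum.cong refl) (simp add: sqrt_diff_eq mass_affine)
  finally have ent: "ent ?pe = ent p + e * ?S" by simp
  have "obj Z b p \<le> obj Z b ?pe" using p pe by (simp add: minimizer_def)
  then have "b * (e * ?S) \<le> e * (pairing Z q - pairing Z p)"
    unfolding obj_def pairing_affine ent distrib_left[of b] by linarith
  then have "e * (b * ?S) \<le> e * (pairing Z q - pairing Z p)"
    by (simp only: mult.left_commute)
  with e show ?thesis by (simp only: mult_le_cancel_left_pos)
qed

text \<open>The square root has infinite slope at 0, which keeps minimizers off the boundary.\<close>

lemma minimizer_pos:
  assumes p: "minimizer Z b p" and b: "0 < b" and a: "a \<in> leaves G"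
  shows "0 < p a"
proof (rule ccontr)
  assume "\<not> 0 < p a"
  have ps: "p \<in> prob_simplex G" using p by (rule minimizer_simplex)
  with \<open>\<not> 0 < p a\<close> a have pa: "p a = 0" using simplex_nonneg[OF ps a] by simp
  define q where "q = (\<lambda>x. of_bool (x = a) :: real)"
  have q: "q \<in> prob_simplex G" using a by (simp add: q_def prob_simplex_def)
  have an: "a \<in> nonroot G" using a by (rule leaf_in_nonroot)
  \<comment> \<open>A node with \<open>mass G p v = 0\<close> contributes 0 here by division by
    zero. That is a valid bound, as such a node can only gain mass on the way to
    \<open>q\<close>.\<close>
  define B where "B = (\<Sum>v\<in>nonroot G - {a}. weight v * (1 / sqrt (mass G p v)))"
  have "b * (weight a * (1 / sqrt e) - B) \<le> pairing Z q - pairing Z p" if e: "0 < e" "e \<le> 1" for e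
  proof -
    let ?t = "\<lambda>v. (mass G q v - mass G p v) /
            (sqrt (mass G p v + e * (mass G q v - mass G p v)) + sqrt (mass G p v))"
    have "- (1 / sqrt (mass G p v)) \<le> ?t v" for v
    proof (cases "mass G p v = 0")
      case True
      then show ?thesis using mass_nonneg[OF q] e by simp
    next
      case False
      then have pv: "0 < mass G p v" using mass_nonneg[OF ps, of v] by simp
      let ?pe = "mass G p v + e * (mass G q v - mass G p v)"
      have "0 \<le> ?pe"
        using mass_nonneg[OF simplex_affine[OF ps q], of e v] e by (simp add: mass_affine)
      then have den: "sqrt (mass G p v) \<le> sqrt ?pe + sqrt (mass G p v)" by simp
      have "0 < sqrt (mass G p v)" using pv by simp
      with den have den_pos: "0 < sqrt ?pe + sqrt (mass G p v)" by (rule less_le_trans[rotated])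
      have "- 1 \<le> mass G q v - mass G p v"
        using mass_nonneg[OF q, of v] mass_le_1[OF ps, of v] by simp
      then have "- 1 / (sqrt ?pe + sqrt (mass G p v)) \<le> ?t v"
        by (rule divide_right_mono) (use den_pos in simp)
      moreover have "1 / (sqrt ?pe + sqrt (mass G p v)) \<le> 1 / sqrt (mass G p v)"
        using den_pos pv by (intro divide_left_mono den mult_pos_pos) auto
      ultimately show ?thesis by simp
    qed
    then have "weight v * - (1 / sqrt (mass G p v)) \<le> weight v * ?t v" if "v \<in> nonroot G - {a}" for v
      using that weight_pos[of v] by (intro mult_left_mono) auto
    then have "- B \<le> (\<Sum>v\<in>nonroot G - {a}. weight v * ?t v)"
      unfolding B_def sum_negf[symmetric] by (intro sum_mono) simp
    moreover have "?t a = 1 / sqrt e"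
      using pa by (simp add: mass_leaf[OF a] q_def)
    ultimately have "weight a * (1 / sqrt e) - B \<le> (\<Sum>v\<in>nonroot G. weight v * ?t v)"
      by (subst sum.remove[OF finite_nonroot an]) simp
    then have "b * (weight a * (1 / sqrt e) - B) \<le> b * (\<Sum>v\<in>nonroot G. weight v * ?t v)"
      using b by simp
    also have "\<dots> \<le> pairing Z q - pairing Z p"
      by (rule minimizer_segment[OF p q e])
    finally show ?thesis .
  qed
  note bound = this
  \<comment> \<open>With the step length \<open>e\<close> below, \<open>weight a / sqrt e\<close>
    equals \<open>M\<close>, which exceeds \<open>B\<close> and the scaled pairing difference
    together. The summand \<open>weight a\<close> ensures that \<open>e\<close> is at most
    1.\<close>
  define M where "M = \<bar>pairing Z q - pairing Z p\<bar> / b + \<bar>B\<bar> + 1 + weight a"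
  define e where "e = (weight a / M)\<^sup>2"
  have w: "0 < weight a" using an by (rule weight_pos)
  have "0 \<le> \<bar>pairing Z q - pairing Z p\<bar> / b" using b by simp
  then have M: "weight a < M" unfolding M_def by linarith
  have "0 < e" "e \<le> 1" using w M by (auto simp: e_def power_le_one)
  then have "b * (weight a * (1 / sqrt e) - B) \<le> pairing Z q - pairing Z p" by (rule bound)
  moreover have "sqrt e = weight a / M" using w M by (simp add: e_def)
  ultimately have "b * (M - B) \<le> pairing Z q - pairing Z p"
    using w M by simp
  then have "M - B \<le> (pairing Z q - pairing Z p) / b"
    using b by (simp add: field_simps)
  also have "\<dots> \<le> \<bar>pairing Z q - pairing Z p\<bar> / b"
    using b by (intro divide_right_mono) auto
  finally show False using w by (simp add: M_def)
qed

text \<open>The limit of \<open>minimizer_segment\<close> as the step length tends to 0; positive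
  masses keep the denominators away from 0.\<close>

lemma minimizer_first_order:
  assumes p: "minimizer Z b p" and b: "0 < b" and q: "q \<in> prob_simplex G"
  shows "b * (\<Sum>v\<in>nonroot G. weight v * ((mass G q v - mass G p v) / (2 * sqrt (mass G p v))))
         \<le> pairing Z q - pairing Z p"
proof -
  have pos: "0 < mass G p v" if "v \<in> nonroot G" for v
    using that minimizer_pos[OF p b] by (intro mass_pos) (auto simp: nonroot_def)
  let ?f = "\<lambda>e. b * (\<Sum>v\<in>nonroot G. weight v * ((mass G q v - mass G p v) /
            (sqrt (mass G p v + e * (mass G q v - mass G p v)) + sqrt (mass G p v))))"
  have lim: "(?f \<longlongrightarrow> b * (\<Sum>v\<in>nonroot G. weight v * ((mass G q v - mass G p v) /
            (sqrt (mass G p v + 0 * (mass G q v - mass G p v)) + sqrt (mass G p v))))) (at_right 0)"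
    by (intro tendsto_intros) (simp add: pos[THEN less_imp_neq, THEN not_sym])
  have "eventually (\<lambda>e. ?f e \<le> pairing Z q - pairing Z p) (at_right 0)"
    by (rule eventually_mono[OF eventually_at_right_real[OF zero_less_one]],
        rule minimizer_segment[OF p q]) simp_all
  from tendsto_upperbound[OF lim this] show ?thesis
    by (simp only: mult_2 mult_zero_left add_0_right trivial_limit_at_right_real not_False_eq_True)
qed

text \<open>Each summand on the left is the Bregman divergence of minus the square root between two
  masses. The linear pairing has no divergence of its own, so the first-order condition leaves this
  growth around the minimizer.\<close>

lemma minimizer_bregman:
  assumes p: "minimizer Z b p" and b: "0 < b" and q: "q \<in> prob_simplex G"
  shows "b * (\<Sum>v\<in>nonroot G. weight v * ((sqrt (mass G q v) - sqrt (mass G p v))\<^sup>2 / (2 * sqrt (mass G p v))))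
         \<le> obj Z b q - obj Z b p"
proof -
  have pos: "0 < mass G p v" if "v \<in> nonroot G" for v
    using that minimizer_pos[OF p b] by (intro mass_pos) (auto simp: nonroot_def)
  have eq: "(sqrt x - sqrt y)\<^sup>2 / (2 * sqrt y) = (x - y) / (2 * sqrt y) - (sqrt x - sqrt y)"
    if "0 \<le> x" "0 < y" for x y :: real
    using that by (simp add: field_simps power2_eq_square)
  have "(\<Sum>v\<in>nonroot G. weight v * ((sqrt (mass G q v) - sqrt (mass G p v))\<^sup>2 / (2 * sqrt (mass G p v))))
    = (\<Sum>v\<in>nonroot G. weight v * ((mass G q v - mass G p v) / (2 * sqrt (mass G p v)) - (sqrt (mass G q v) - sqrt (mass G p v))))"
    by (intro sum.cong refl) (simp only: eq[OF mass_nonneg[OF q] pos])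
  also have "\<dots> = (\<Sum>v\<in>nonroot G. weight v * ((mass G q v - mass G p v) / (2 * sqrt (mass G p v)))) - (ent q - ent p)"
    by (simp only: ent_def sum_subtractf right_diff_distrib)
  finally have "b * (\<Sum>v\<in>nonroot G. weight v * ((sqrt (mass G q v) - sqrt (mass G p v))\<^sup>2 / (2 * sqrt (mass G p v))))
    = b * (\<Sum>v\<in>nonroot G. weight v * ((mass G q v - mass G p v) / (2 * sqrt (mass G p v)))) - b * (ent q - ent p)"
    by (simp only: right_diff_distrib[of b])
  then show ?thesis
    using minimizer_first_order[OF p b q] unfolding obj_def right_diff_distrib[of b "ent q"] by linarith
qed

text \<open>Only the summand of the leaf \<open>a\<close> is kept. Square roots of probabilities are
  at most 1, so \<open>(q a - p a)\<^sup>2\<close> is at most four times the squared difference of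
  the roots, and \<open>1 / (2 * sqrt (p a))\<close> is at least \<open>1/2\<close>; hence the
  factor \<open>1/8\<close>.\<close>

lemma bregman_lower:
  assumes p: "minimizer Z b p" and b: "0 < b" and q: "q \<in> prob_simplex G" and a: "a \<in> leaves G"
  shows "b * R L / 8 * (q a - p a)\<^sup>2 \<le> obj Z b q - obj Z b p"
proof -
  have an: "a \<in> nonroot G" using a by (rule leaf_in_nonroot)
  have pa: "0 < p a" using minimizer_pos[OF p b a] .
  have p1: "p a \<le> 1" using simplex_le_1[OF minimizer_simplex[OF p] a] .
  have q0: "0 \<le> q a" "q a \<le> 1" using simplex_nonneg[OF q a] simplex_le_1[OF q a] by auto
  have "(q a - p a)\<^sup>2 = ((sqrt (q a) - sqrt (p a)) * (sqrt (q a) + sqrt (p a)))\<^sup>2"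
    using pa q0 by (simp add: algebra_simps)
  also have "\<dots> \<le> (sqrt (q a) - sqrt (p a))\<^sup>2 * 2\<^sup>2"
  proof -
    have "sqrt (q a) \<le> 1" "sqrt (p a) \<le> 1" using p1 q0 by auto
    then have "sqrt (q a) + sqrt (p a) \<le> 2" by linarith
    then show ?thesis
      unfolding power_mult_distrib using pa q0 by (intro mult_left_mono power_mono) auto
  qed
  also have "\<dots> \<le> (sqrt (q a) - sqrt (p a))\<^sup>2 * (4 / sqrt (p a))"
    using pa p1 by (intro mult_left_mono) (auto simp: field_simps)
  finally have "1 / 8 * (q a - p a)\<^sup>2 \<le> (sqrt (q a) - sqrt (p a))\<^sup>2 / (2 * sqrt (p a))"
    by (simp add: mult.commute)
  then have "b * (weight a * (1 / 8 * (q a - p a)\<^sup>2))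
      \<le> b * (weight a * ((sqrt (mass G q a) - sqrt (mass G p a))\<^sup>2 / (2 * sqrt (mass G p a))))"
    using b weight_pos[OF an] by (intro mult_left_mono) (auto simp: mass_leaf[OF a])
  also have "\<dots> \<le> b * (\<Sum>v\<in>nonroot G. weight v * ((sqrt (mass G q v) - sqrt (mass G p v))\<^sup>2 / (2 * sqrt (mass G p v))))"
    using b an weight_pos mass_nonneg[OF minimizer_simplex[OF p]]
    by (intro mult_left_mono member_le_sum mult_nonneg_nonneg divide_nonneg_nonneg) (auto intro: less_imp_le)
  also have "\<dots> \<le> obj Z b q - obj Z b p"
    by (rule minimizer_bregman[OF p b q])
  finally show ?thesis using a depth_leaf[OF a] by (simp add: weight_def)
qed

text \<open>Adding the growth of each objective at the minimizer of the other one cancels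
  \<open>ent\<close> and leaves a pairing with \<open>Z - Z'\<close>. This gives uniqueness on the
  leaves when \<open>Z = Z'\<close>, and in general the modulus of continuity behind the
  measurability of the strategy.\<close>

lemma minimizer_hoelder:
  assumes p: "minimizer Z b p" and p': "minimizer Z' b p'" and b: "0 < b" and a: "a \<in> leaves G"
  shows "(p' a - p a)\<^sup>2 \<le> 4 / (b * R L) * (\<Sum>a\<in>leaves G. \<bar>Z a - Z' a\<bar>)"
proof -
  have ps: "p \<in> prob_simplex G" "p' \<in> prob_simplex G" using p p' by (auto intro: minimizer_simplex)
  have bR: "0 < b * R L" using b R_pos[OF one_le_L] by simp
  have "b * R L / 8 * (p' a - p a)\<^sup>2 + b * R L / 8 * (p a - p' a)\<^sup>2
      \<le> (obj Z b p' - obj Z b p) + (obj Z' b p - obj Z' b p')"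
    using ps by (intro add_mono bregman_lower p p' b a)
  also have "\<dots> = (\<Sum>a\<in>leaves G. (Z a - Z' a) * (p' a - p a))"
    by (simp add: obj_def pairing_def sum.distrib sum_subtractf algebra_simps)
  also have "\<dots> \<le> (\<Sum>a\<in>leaves G. \<bar>Z a - Z' a\<bar>)"
  proof (rule sum_mono)
    fix a assume a: "a \<in> leaves G"
    have "\<bar>p' a - p a\<bar> \<le> 1"
      using simplex_nonneg[OF ps(1) a] simplex_nonneg[OF ps(2) a] simplex_le_1[OF ps(1) a] simplex_le_1[OF ps(2) a]
      by linarith
    then have "\<bar>(Z a - Z' a) * (p' a - p a)\<bar> \<le> \<bar>Z a - Z' a\<bar>"
      unfolding abs_mult by (rule mult_left_le) simp
    then show "(Z a - Z' a) * (p' a - p a) \<le> \<bar>Z a - Z' a\<bar>" by linarith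
  qed
  finally have "b * R L / 4 * (p' a - p a)\<^sup>2 \<le> (\<Sum>a\<in>leaves G. \<bar>Z a - Z' a\<bar>)"
    by (simp add: power2_commute[of "p a"])
  with bR show ?thesis by (simp add: field_simps)
qed

section \<open>Stability and the pathwise regret bound\<close>

text \<open>
  The played loss subtracted here is constant on each level, so it does not change pairings with
  differences of points of the simplex.
\<close>

definition centered :: "('v \<Rightarrow> real) \<Rightarrow> 'v round \<Rightarrow> 'v \<Rightarrow> real" where
  "centered p r v = of_bool (ancestor G v (snd r)) * (fst r v / mass G p v) - fst r (proj (depth G v) (snd r))"

text \<open>The bound of \<open>stability_scalar\<close> with \<open>c = b * weight v\<close>,
  summed over the nodes.\<close>

definition stab :: "real \<Rightarrow> ('v \<Rightarrow> real) \<Rightarrow> 'v round \<Rightarrow> real" where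
  "stab b p r = 5 / 2 * (\<Sum>v\<in>nonroot G. mass G p v * sqrt (mass G p v) * (centered p r v)\<^sup>2 / (b * weight v))"

text \<open>Up to the factor \<open>5 / 2 / b\<close>, the bound on the conditional expectation of
  \<open>stab\<close>. Its summands vanish at mass 0 and at mass 1.\<close>

definition spread :: "('v \<Rightarrow> real) \<Rightarrow> real" where
  "spread p = (\<Sum>v\<in>nonroot G. weight v * (sqrt (mass G p v) * (1 - mass G p v)))"

definition bounded_loss :: "('v \<Rightarrow> real) \<Rightarrow> bool" where
  "bounded_loss l \<longleftrightarrow> (\<forall>v\<in>nonroot G. 0 \<le> l v \<and> l v \<le> weight v)"

lemma pairing_loss_estimate:
  "pairing (loss_estimate G p r) q =
     (\<Sum>v\<in>nonroot G. of_bool (ancestor G v (snd r)) * (fst r v / mass G p v) * mass G q v)"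
  unfolding pairing_def loss_estimate_def by (rule sum_path_mult)

lemma pairing_loss_estimate_self:
  assumes "\<And>v. v \<in> nonroot G \<Longrightarrow> 0 < mass G p v"
  shows "pairing (loss_estimate G p r) p = action_loss G (fst r) (snd r)"
  unfolding pairing_loss_estimate action_loss_def sum_path_eq
  by (intro sum.cong refl) (use assms in force)

text \<open>The loss of \<open>v\<close> enters the estimate with probability
  \<open>mass G p v\<close>, which cancels the importance weight.\<close>

lemma loss_estimate_unbiased:
  assumes "\<And>v. v \<in> nonroot G \<Longrightarrow> 0 < mass G p v"
  shows "(\<Sum>A\<in>leaves G. p A * loss_estimate G p (l, A) a) = action_loss G l a"
proof -
  have "(\<Sum>A\<in>leaves G. p A * loss_estimate G p (l, A) a)
      = (\<Sum>v\<in>path G a. \<Sum>A\<in>leaves G. p A * (of_bool (ancestor G v A) * (l v / mass G p v)))"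
    by (simp only: loss_estimate_def sum_distrib_left fst_conv snd_conv sum.swap[of _ "leaves G"])
  also have "\<dots> = (\<Sum>v\<in>path G a. l v / mass G p v * mass G p v)"
    unfolding mass_eq[of p] sum_distrib_left
    by (intro sum.cong refl) (simp only: mult_ac)
  also have "\<dots> = (\<Sum>v\<in>path G a. l v)"
    by (intro sum.cong refl) (use assms in \<open>force simp: path_def\<close>)
  finally show ?thesis by (simp add: action_loss_def)
qed

lemma pairing_centered:
  assumes "p' \<in> prob_simplex G" "q \<in> prob_simplex G"
  shows "pairing (loss_estimate G p r) p' - pairing (loss_estimate G p r) q
       = (\<Sum>v\<in>nonroot G. centered p r v * (mass G p' v - mass G q v))"
proof -
  have "(\<Sum>v\<in>nonroot G. fst r (proj (depth G v) (snd r)) * (mass G p' v - mass G q v))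
      = (\<Sum>j=1..L. \<Sum>v\<in>level G j. fst r (proj j (snd r)) * (mass G p' v - mass G q v))"
    unfolding sum_nonroot by (intro sum.cong refl) (simp add: level_def)
  also have "\<dots> = 0"
    using assms by (intro sum.neutral[of "{1..L}"] ballI)
       (simp add: sum_subtractf sum_level_simplex flip: sum_distrib_left)
  finally show ?thesis
    by (simp add: pairing_loss_estimate centered_def left_diff_distrib sum_subtractf right_diff_distrib)
qed

lemma loss_proj_bounds:
  assumes "bounded_loss l" "A \<in> leaves G" "v \<in> nonroot G"
  shows "0 \<le> l (proj (depth G v) A)" "l (proj (depth G v) A) \<le> weight v"
proof -
  let ?u = "proj (depth G v) A"
  have u: "?u \<in> level G (depth G v)"
    using assms depth_nonroot by (intro proj_in_level) auto
  then have "?u \<in> nonroot G"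
    using level_subset_nonroot depth_nonroot[OF assms(3)] by auto
  moreover have "weight ?u = weight v" using u by (simp add: weight_level weight_def level_def)
  ultimately show "0 \<le> l ?u" "l ?u \<le> weight v"
    using assms(1) by (auto simp: bounded_loss_def)
qed

text \<open>After centering, \<open>stability_scalar\<close> applies at every node. The divergence
  terms that it consumes are paid for by the growth of the objective at its minimizer.\<close>

lemma stability:
  assumes p: "minimizer Z b p" and b: "10 \<le> b" and q: "q \<in> prob_simplex G"
    and l: "bounded_loss (fst r)" and A: "snd r \<in> leaves G"
  shows "pairing (loss_estimate G p r) p \<le>
     pairing (loss_estimate G p r) q + stab b p r + (obj Z b q - obj Z b p)"
proof -
  have b0: "0 < b" using b by simp
  have ps: "p \<in> prob_simplex G" using p by (rule minimizer_simplex)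
  have "centered p r v * (mass G p v - mass G q v)
      \<le> b * (weight v * ((sqrt (mass G q v) - sqrt (mass G p v))\<^sup>2 / (2 * sqrt (mass G p v))))
        + 5 / 2 * (mass G p v * sqrt (mass G p v) * (centered p r v)\<^sup>2 / (b * weight v))"
    if v: "v \<in> nonroot G" for v
  proof -
    have pv: "0 < mass G p v"
      using v minimizer_pos[OF p b0] by (intro mass_pos) (auto simp: nonroot_def)
    have w: "0 < weight v" using v by (rule weight_pos)
    have "0 \<le> of_bool (ancestor G v (snd r)) * (fst r v / mass G p v)"
      using l v pv by (auto simp: bounded_loss_def)
    \<comment> \<open>The importance weighted part is nonnegative, so only the subtracted loss can
      make the centered estimate negative. Together with \<open>10 \<le> b\<close> this is the
      hypothesis of \<open>stability_scalar\<close>.\<close>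
    then have "- weight v \<le> centered p r v"
      using loss_proj_bounds[OF l A v] by (simp add: centered_def)
    then have "10 * sqrt (mass G p v) * - weight v \<le> 10 * sqrt (mass G p v) * centered p r v"
      using pv by (intro mult_left_mono) auto
    moreover have "10 * sqrt (mass G p v) * weight v \<le> b * weight v"
    proof (rule mult_right_mono)
      have "sqrt (mass G p v) \<le> 1" using mass_le_1[OF ps] by simp
      with b show "10 * sqrt (mass G p v) \<le> b" by linarith
    qed (use w in simp)
    ultimately have "- (b * weight v) \<le> 10 * sqrt (mass G p v) * centered p r v"
      unfolding mult_minus_right by linarith
    from stability_scalar[OF pv mass_nonneg[OF q, of v] mult_pos_pos[OF b0 w] this] show ?thesis
      unfolding mult.assoc[of b "weight v"] by linarith
  qed
  then have "(\<Sum>v\<in>nonroot G. centered p r v * (mass G p v - mass G q v))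
     \<le> b * (\<Sum>v\<in>nonroot G. weight v * ((sqrt (mass G q v) - sqrt (mass G p v))\<^sup>2 / (2 * sqrt (mass G p v))))
       + stab b p r"
    unfolding stab_def sum_distrib_left sum.distrib[symmetric] by (intro sum_mono) auto
  then show ?thesis
    using minimizer_bregman[OF p b0 q] pairing_centered[OF ps q, of p r] by linarith
qed

lemma stab_nonneg:
  assumes "p \<in> prob_simplex G" "0 < b"
  shows "0 \<le> stab b p r"
  unfolding stab_def using assms mass_nonneg weight_pos
  by (intro mult_nonneg_nonneg sum_nonneg divide_nonneg_nonneg) (auto intro: less_imp_le)

lemma spread_nonneg: "p \<in> prob_simplex G \<Longrightarrow> 0 \<le> spread p"
  unfolding spread_def using mass_nonneg mass_le_1 weight_pos
  by (intro sum_nonneg mult_nonneg_nonneg) (auto intro: less_imp_le)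

text \<open>With probability \<open>m = mass G p v\<close> the node is on the played path and the
  centered estimate is \<open>l v * (1 - m) / m\<close>; otherwise its modulus is a loss on the same
  level, at most \<open>weight v\<close>. The two contributions add up because
  \<open>(1 - m)\<^sup>2 / m + (1 - m) = (1 - m) / m\<close>.\<close>

lemma centered_second_moment:
  assumes ps: "p \<in> prob_simplex G" and l: "bounded_loss l" and v: "v \<in> nonroot G"
    and m: "0 < mass G p v"
  shows "(\<Sum>A\<in>leaves G. p A * (centered p (l, A) v)\<^sup>2) \<le> (weight v)\<^sup>2 * (1 - mass G p v) / mass G p v"
proof -
  let ?m = "mass G p v" and ?w = "weight v" and ?anc = "\<lambda>A. ancestor G v A"
  have m1: "?m \<le> 1" using ps by (rule mass_le_1)
  have w: "0 < ?w" using v by (rule weight_pos)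
  have "(centered p (l, A) v)\<^sup>2 \<le> of_bool (?anc A) * (?w * (1 - ?m) / ?m)\<^sup>2 + (1 - of_bool (?anc A)) * ?w\<^sup>2"
    if A: "A \<in> leaves G" for A
  proof (cases "?anc A")
    case True
    then have "proj (depth G v) A = v"
      using A v by (simp add: ancestor_leaf_iff nonroot_def)
    with True have "centered p (l, A) v = l v * (1 - ?m) / ?m"
      using m by (simp add: centered_def field_simps)
    moreover have "0 \<le> l v" "l v \<le> ?w" using l v by (auto simp: bounded_loss_def)
    ultimately show ?thesis
      using True m m1 by (auto intro!: power_mono divide_right_mono mult_right_mono)
  next
    case False
    then show ?thesis
      using loss_proj_bounds[OF l A v] by (simp add: centered_def power_mono)
  qed
  then have "(\<Sum>A\<in>leaves G. p A * (centered p (l, A) v)\<^sup>2)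
     \<le> (\<Sum>A\<in>leaves G. p A * (of_bool (?anc A) * (?w * (1 - ?m) / ?m)\<^sup>2 + (1 - of_bool (?anc A)) * ?w\<^sup>2))"
    using ps by (intro sum_mono mult_left_mono) (auto simp: simplex_nonneg)
  also have "\<dots> = (\<Sum>A\<in>leaves G. (?w * (1 - ?m) / ?m)\<^sup>2 * (of_bool (?anc A) * p A)
                + ?w\<^sup>2 * (p A - of_bool (?anc A) * p A))"
    by (intro sum.cong refl) (simp add: algebra_simps)
  also have "\<dots> = (?w * (1 - ?m) / ?m)\<^sup>2 * ?m + ?w\<^sup>2 * (1 - ?m)"
    unfolding sum.distrib sum_distrib_left[symmetric] sum_subtractf mass_eq[symmetric] simplex_sum[OF ps] ..
  also have "\<dots> = ?w\<^sup>2 * (1 - ?m) / ?m"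
    using m by (simp add: field_simps power2_eq_square)
  finally show ?thesis .
qed

lemma stab_expectation:
  assumes ps: "p \<in> prob_simplex G" and l: "bounded_loss l" and b: "0 < b"
    and pos: "\<And>v. v \<in> nonroot G \<Longrightarrow> 0 < mass G p v"
  shows "(\<Sum>A\<in>leaves G. p A * stab b p (l, A)) \<le> 5 / 2 / b * spread p"
proof -
  let ?c = "\<lambda>v. mass G p v * sqrt (mass G p v) / (b * weight v)"
  have "(\<Sum>A\<in>leaves G. p A * stab b p (l, A))
      = (\<Sum>A\<in>leaves G. \<Sum>v\<in>nonroot G. 5 / 2 * (?c v * (p A * (centered p (l, A) v)\<^sup>2)))"
    unfolding stab_def sum_distrib_left by (intro sum.cong refl) simp
  also have "\<dots> = (\<Sum>v\<in>nonroot G. \<Sum>A\<in>leaves G. 5 / 2 * (?c v * (p A * (centered p (l, A) v)\<^sup>2)))"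
    by (rule sum.swap)
  also have "\<dots> = (\<Sum>v\<in>nonroot G. 5 / 2 * (?c v * (\<Sum>A\<in>leaves G. p A * (centered p (l, A) v)\<^sup>2)))"
    by (simp only: sum_distrib_left)
  also have "\<dots> \<le> (\<Sum>v\<in>nonroot G. 5 / 2 * (?c v * ((weight v)\<^sup>2 * (1 - mass G p v) / mass G p v)))"
    using b weight_pos pos
    by (intro sum_mono mult_left_mono centered_second_moment ps l) (auto simp: less_imp_le)
  also have "\<dots> = (\<Sum>v\<in>nonroot G. 5 / 2 / b * (weight v * (sqrt (mass G p v) * (1 - mass G p v))))"
  proof (intro sum.cong refl)
    fix v assume "v \<in> nonroot G"
    then have "weight v \<noteq> 0" "mass G p v \<noteq> 0" using weight_pos pos by force+
    then show "5 / 2 * (?c v * ((weight v)\<^sup>2 * (1 - mass G p v) / mass G p v))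
       = 5 / 2 / b * (weight v * (sqrt (mass G p v) * (1 - mass G p v)))"
      using b by (simp add: field_simps power2_eq_square)
  qed
  also have "\<dots> = 5 / 2 / b * spread p"
    by (simp only: spread_def sum_distrib_left)
  finally show ?thesis .
qed

text \<open>The excess over the value of \<open>ent\<close> at a vertex of the simplex. Against a
  fixed leaf, regularization costs only this excess.\<close>

definition ent_gap :: "('v \<Rightarrow> real) \<Rightarrow> real" where
  "ent_gap p = ent p - (\<Sum>j=1..L. R j)"

lemma ent_vertex:
  assumes a: "a \<in> leaves G"
  shows "ent (\<lambda>x. of_bool (x = a)) = (\<Sum>j=1..L. R j)"
proof -
  have "mass G (\<lambda>x. of_bool (x = a)) v = of_bool (ancestor G v a)" for v
    using a by (simp add: mass_eq)
  then have "ent (\<lambda>x. of_bool (x = a)) = (\<Sum>v\<in>path G a. weight v)"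
    unfolding ent_def sum_path_eq by (intro sum.cong) auto
  also have "\<dots> = (\<Sum>j=1..L. R j)"
    using a proj_in_level weight_level unfolding sum_path_proj[OF a] by (intro sum.cong) auto
  finally show ?thesis .
qed

text \<open>The telescope: \<open>stability\<close> in round \<open>t\<close> is used with
  \<open>q = P (t + 1)\<close>, whose objective changes in the next round only by the new estimate
  and by the rate increment times \<open>ent\<close>.\<close>

lemma ftrl_pathwise:
  fixes P :: "nat \<Rightarrow> 'v \<Rightarrow> real" and r :: "nat \<Rightarrow> 'v round" and b :: "nat \<Rightarrow> real"
  defines "z \<equiv> \<lambda>t. loss_estimate G (P t) (r t)"
  assumes P: "\<And>t. t \<le> n \<Longrightarrow> minimizer (\<lambda>a. \<Sum>s<t. z s a) (b t) (P t)"
    and b: "\<And>t. 10 \<le> b t"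
    and r: "\<And>t. t \<le> n \<Longrightarrow> bounded_loss (fst (r t)) \<and> snd (r t) \<in> leaves G"
    and u: "u \<in> leaves G"
  shows "(\<Sum>t\<le>n. action_loss G (fst (r t)) (snd (r t))) - (\<Sum>t\<le>n. z t u)
     \<le> (\<Sum>t\<le>n. stab (b t) (P t) (r t)) + b 0 * ent_gap (P 0)
       + (\<Sum>t=1..n. (b t - b (t - 1)) * ent_gap (P t))"
proof -
  let ?Z = "\<lambda>t a. \<Sum>s<t. z s a"
  have b0: "0 < b t" for t using b[of t] by simp
  have played: "pairing (z t) (P t) = action_loss G (fst (r t)) (snd (r t))" if "t \<le> n" for t
    unfolding z_def using minimizer_pos[OF P[OF that] b0]
    by (intro pairing_loss_estimate_self mass_pos) (auto simp: nonroot_def)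
  have pairing_Z: "pairing (?Z (Suc t)) q = pairing (?Z t) q + pairing (z t) q" for t q
    by (simp add: pairing_def sum.distrib algebra_simps)
  have step: "pairing (z t) (P t) \<le> pairing (z t) q + stab (b t) (P t) (r t)
     + (obj (?Z t) (b t) q - obj (?Z t) (b t) (P t))" if "t \<le> n" "q \<in> prob_simplex G" for t q
    unfolding z_def by (rule stability) (use P[OF that(1)] b r that in \<open>auto simp: z_def\<close>)
  have partial: "(\<Sum>t<m. pairing (z t) (P t)) \<le> (\<Sum>t<m. stab (b t) (P t) (r t))
      + obj (?Z m) (b m) (P m) + b 0 * ent (P 0) + (\<Sum>t=1..m. (b t - b (t - 1)) * ent (P t))"
    if "m \<le> n" for m
    using that
  proof (induction m)
    case 0
    show ?case by (simp add: obj_def pairing_def)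
  next
    case (Suc m)
    have "obj (?Z (Suc m)) (b (Suc m)) (P (Suc m)) = obj (?Z m) (b m) (P (Suc m)) + pairing (z m) (P (Suc m))
       - (b (Suc m) - b m) * ent (P (Suc m))"
      unfolding obj_def pairing_Z by (simp add: algebra_simps)
    moreover have "P (Suc m) \<in> prob_simplex G" using P Suc.prems by (blast intro: minimizer_simplex)
    ultimately show ?case using Suc step[of m "P (Suc m)"] by simp
  qed
  \<comment> \<open>In the last round the comparison point is the vertex \<open>u\<close> itself, so
    no minimizer after round \<open>n\<close> is involved.\<close>
  let ?u = "\<lambda>x. of_bool (x = u) :: real"
  have us: "?u \<in> prob_simplex G" using u by (simp add: prob_simplex_def)
  have "(\<Sum>t\<le>n. pairing (z t) (P t)) \<le> (\<Sum>t\<le>n. stab (b t) (P t) (r t))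
      + (pairing (?Z n) ?u + pairing (z n) ?u) - b n * ent ?u
      + b 0 * ent (P 0) + (\<Sum>t=1..n. (b t - b (t - 1)) * ent (P t))"
    using partial[of n] step[of n ?u] us unfolding obj_def lessThan_Suc_atMost[symmetric] by simp
  moreover have "pairing (?Z n) ?u + pairing (z n) ?u = (\<Sum>t\<le>n. z t u)"
    using u unfolding pairing_Z[symmetric] by (simp add: pairing_def flip: lessThan_Suc_atMost)
  ultimately have main: "(\<Sum>t\<le>n. pairing (z t) (P t)) - (\<Sum>t\<le>n. z t u) \<le> (\<Sum>t\<le>n. stab (b t) (P t) (r t))
      - b n * ent ?u + b 0 * ent (P 0) + (\<Sum>t=1..n. (b t - b (t - 1)) * ent (P t))"
    by linarith
  let ?C = "\<Sum>j=1..L. R j"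
  \<comment> \<open>Spreading \<open>b n\<close> over its increments charges the vertex value to
    each penalty term, which turns every \<open>ent\<close> into \<open>ent_gap\<close>.\<close>
  have "b n = b 0 + (\<Sum>t=1..n. b t - b (t - 1))"
    by (induction n) auto
  then have "b n * ?C = b 0 * ?C + (\<Sum>t=1..n. (b t - b (t - 1)) * ?C)"
    by (simp only: distrib_right sum_distrib_right)
  moreover have "(\<Sum>t=1..n. (b t - b (t - 1)) * ent_gap (P t))
      = (\<Sum>t=1..n. (b t - b (t - 1)) * ent (P t)) - (\<Sum>t=1..n. (b t - b (t - 1)) * ?C)"
    by (simp only: ent_gap_def right_diff_distrib sum_subtractf)
  moreover have "b 0 * ent_gap (P 0) = b 0 * ent (P 0) - b 0 * ?C"
    by (simp only: ent_gap_def right_diff_distrib)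
  moreover have "ent ?u = ?C" using u by (rule ent_vertex)
  ultimately have "- b n * ent ?u + b 0 * ent (P 0) + (\<Sum>t=1..n. (b t - b (t - 1)) * ent (P t))
     = b 0 * ent_gap (P 0) + (\<Sum>t=1..n. (b t - b (t - 1)) * ent_gap (P t))"
    by simp
  with main show ?thesis using played by simp
qed

end

section \<open>Summing the round bounds\<close>

definition rate :: "nat \<Rightarrow> real" where
  "rate t = sqrt (5 * real (max (t + 1) 20))"

text \<open>Taking the rate before the first round to be 0 merges the initial penalty with the later
  increments.\<close>

definition rate_step :: "nat \<Rightarrow> real" where
  "rate_step t = (if t = 0 then rate 0 else rate t - rate (t - 1))"

lemma rate_ge_10: "10 \<le> rate t"
  unfolding rate_def by (intro real_le_rsqrt) simp

lemma rate_mono: "s \<le> t \<Longrightarrow> rate s \<le> rate t"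
  unfolding rate_def by (intro real_sqrt_le_mono) simp

lemma rate_step_nonneg: "0 \<le> rate_step t"
  using rate_mono[of "t - 1" t] rate_ge_10[of 0] by (auto simp: rate_step_def)

lemma sum_rate_step: "(\<Sum>t<Suc n. rate_step t) = rate n"
  by (induction n) (auto simp: rate_step_def)

lemma rate_early: "t < 20 \<Longrightarrow> rate t = 10"
  unfolding rate_def by (rule real_sqrt_unique) auto

lemma rate_late: "20 \<le> t \<Longrightarrow> rate t = sqrt 5 * sqrt (real t + 1)"
  unfolding rate_def real_sqrt_mult[symmetric] by simp

lemma sqrt_minus_sqrt_le: "sqrt (real t + 1) - sqrt (real t) \<le> 1 / sqrt (real t + 1)"
proof -
  have "sqrt (real t) * sqrt (real t) \<le> sqrt (real t) * sqrt (real t + 1)"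
    by (intro mult_left_mono) auto
  then have "(sqrt (real t + 1) - sqrt (real t)) * sqrt (real t + 1) \<le> 1"
    by (simp add: algebra_simps)
  then show ?thesis by (simp add: pos_le_divide_eq)
qed

lemma rate_step_late: "20 \<le> t \<Longrightarrow> rate_step t \<le> sqrt 5 / sqrt (real t + 1)"
proof -
  assume t: "20 \<le> t"
  have "rate (t - 1) = sqrt 5 * sqrt (real t)"
  \<comment> \<open>At \<open>t = 20\<close> the previous rate still lies on the plateau, but there
    \<open>sqrt (5 * 20)\<close> agrees with the late formula.\<close>
  proof (cases "t = 20")
    case True
    then show ?thesis by (simp add: rate_def flip: real_sqrt_mult)
  next
    case False
    with t show ?thesis using rate_late[of "t - 1"] by simp
  qed
  with t have "rate_step t = sqrt 5 * (sqrt (real t + 1) - sqrt (real t))"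
    by (simp add: rate_step_def rate_late algebra_simps)
  also have "\<dots> \<le> sqrt 5 * (1 / sqrt (real t + 1))"
    by (intro mult_left_mono sqrt_minus_sqrt_le) simp
  finally show ?thesis by simp
qed

text \<open>Each summand is at most the increment of twice the square root, by the inequality of
  arithmetic and geometric means for \<open>n\<close> and \<open>n + 1\<close>.\<close>

lemma sum_inverse_sqrt: "(\<Sum>t<n. 1 / sqrt (real t + 1)) \<le> 2 * sqrt (real n)"
proof (induction n)
  case (Suc n)
  have "1 / sqrt (real n + 1) \<le> 2 * (sqrt (real n + 1) - sqrt (real n))"
  proof -
    have "sqrt (real n) * sqrt (real n + 1) \<le> real n + 1 / 2"
      using arith_geo_mean_sqrt[of "real n" "real n + 1"] by (simp add: real_sqrt_mult)
    then have "1 \<le> 2 * (sqrt (real n + 1) - sqrt (real n)) * sqrt (real n + 1)"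
      by (simp add: algebra_simps)
    then show ?thesis by (simp add: pos_divide_le_eq)
  qed
  with Suc show ?case by (simp add: add.commute)
qed simp

lemma sum_inverse_rate: "(\<Sum>t<n. 5 / 2 / rate t) \<le> sqrt (5 * real n)"
proof -
  have "5 / 2 / rate t \<le> sqrt 5 / 2 * (1 / sqrt (real t + 1))" for t
  proof -
    have "sqrt 5 * sqrt (real t + 1) \<le> rate t"
      unfolding rate_def real_sqrt_mult[symmetric] by (intro real_sqrt_le_mono) simp
    then have "5 / 2 / rate t \<le> 5 / 2 / (sqrt 5 * sqrt (real t + 1))"
      using rate_ge_10[of t] by (intro divide_left_mono mult_pos_pos) auto
    also have "\<dots> = sqrt 5 / 2 * (1 / sqrt (real t + 1))"
      by (simp add: field_simps)
    finally show ?thesis .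
  qed
  then have "(\<Sum>t<n. 5 / 2 / rate t) \<le> sqrt 5 / 2 * (\<Sum>t<n. 1 / sqrt (real t + 1))"
    unfolding sum_distrib_left by (intro sum_mono)
  also have "\<dots> \<le> sqrt 5 / 2 * (2 * sqrt (real n))"
    by (intro mult_left_mono sum_inverse_sqrt) simp
  finally show ?thesis by (simp add: real_sqrt_mult)
qed

text \<open>Masking the early rounds removes the term \<open>t = 0\<close>, so the usual comparison
  with increments of the logarithm needs no additive 1.\<close>

lemma sum_late_harmonic:
  assumes "1 \<le> n"
  shows "(\<Sum>t<n. if t < 20 then 0 else 1 / (real t + 1)) \<le> ln (real n)"
  using assms
proof (induction n rule: dec_induct)
  case (step n)
  have "1 / (real n + 1) \<le> ln (real (Suc n)) - ln (real n)"
  proof -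
    have "ln (real n / (real n + 1)) \<le> real n / (real n + 1) - 1"
      using step by (intro ln_le_minus_one) simp
    also have "\<dots> = - (1 / (real n + 1))" by (simp add: field_simps)
    finally show ?thesis using step by (simp add: ln_div add.commute)
  qed
  moreover have "(if n < 20 then 0 else 1 / (real n + 1)) \<le> 1 / (real n + 1)" by simp
  ultimately show ?case using step unfolding sum.lessThan_Suc by linarith
qed simp

section \<open>The worst-case sum of the round bounds\<close>

context weighted_tree
begin

definition round_bound :: "nat \<Rightarrow> ('v \<Rightarrow> real) \<Rightarrow> real" where
  "round_bound t p = 5 / 2 / rate t * spread p + rate_step t * ent_gap p"

definition adv_width :: real where
  "adv_width = (\<Sum>j=1..L. R j * sqrt (real (card (level G j))))"

lemma adv_width_nonneg: "0 \<le> adv_width"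
  unfolding adv_width_def using R_pos by (intro sum_nonneg mult_nonneg_nonneg) (auto intro: less_imp_le)

lemma sum_weight_nonroot: "(\<Sum>v\<in>nonroot G. weight v * f v) = (\<Sum>j=1..L. R j * (\<Sum>v\<in>level G j. f v))"
  unfolding sum_nonroot sum_distrib_left by (intro sum.cong refl) (simp add: weight_level)

lemma ent_le:
  assumes "p \<in> prob_simplex G"
  shows "ent p \<le> adv_width"
  unfolding ent_def sum_weight_nonroot adv_width_def
proof (intro sum_mono mult_left_mono)
  fix j assume j: "j \<in> {1..L}"
  have "(\<Sum>v\<in>level G j. 1 * sqrt (mass G p v))\<^sup>2 \<le> (\<Sum>v\<in>level G j. 1\<^sup>2) * (\<Sum>v\<in>level G j. (sqrt (mass G p v))\<^sup>2)"
    by (rule Cauchy_Schwarz_ineq_sum)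
  also have "\<dots> = real (card (level G j))"
    using assms j mass_nonneg by (simp add: sum_level_simplex)
  finally show "(\<Sum>v\<in>level G j. sqrt (mass G p v)) \<le> sqrt (real (card (level G j)))"
    by (simp add: real_le_rsqrt)
qed (use R_pos in \<open>auto intro: less_imp_le\<close>)

lemma ent_gap_le:
  assumes "p \<in> prob_simplex G"
  shows "ent_gap p \<le> adv_width"
proof -
  have "0 \<le> (\<Sum>j=1..L. R j)" using R_pos by (intro sum_nonneg) (auto intro: less_imp_le)
  with ent_le[OF assms] show ?thesis by (simp add: ent_gap_def)
qed

lemma spread_le:
  assumes p: "p \<in> prob_simplex G"
  shows "spread p \<le> adv_width"
proof -
  have "spread p \<le> ent p"
    unfolding spread_def ent_def using mass_nonneg[OF p] weight_pos
    by (intro sum_mono mult_left_mono) (auto intro!: mult_left_le simp: less_imp_le)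
  with ent_le[OF p] show ?thesis by simp
qed

lemma round_bound_le:
  assumes p: "p \<in> prob_simplex G"
  shows "round_bound t p \<le> 5 / 2 / rate t * adv_width + rate_step t * adv_width"
  unfolding round_bound_def using rate_ge_10[of t]
  by (intro add_mono mult_left_mono spread_le ent_gap_le p rate_step_nonneg) auto

lemma adversarial_bound:
  assumes "1 \<le> n" and P: "\<And>t. t < n \<Longrightarrow> P t \<in> prob_simplex G"
  shows "(\<Sum>t<n. round_bound t (P t)) \<le> 15 * adv_width + 4 * (sqrt (5 * real n) * adv_width)"
proof -
  have "(\<Sum>t<n. round_bound t (P t)) \<le> (\<Sum>t<n. 5 / 2 / rate t * adv_width + rate_step t * adv_width)"
    using P by (intro sum_mono round_bound_le) auto
  also have "\<dots> = ((\<Sum>t<n. 5 / 2 / rate t) + (\<Sum>t<n. rate_step t)) * adv_width"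
    by (simp only: sum.distrib sum_distrib_right distrib_right)
  also have "\<dots> \<le> (sqrt (5 * real n) + (10 + sqrt (5 * real n))) * adv_width"
  proof (intro mult_right_mono add_mono adv_width_nonneg sum_inverse_rate)
    obtain m where m: "n = Suc m" using assms(1) by (cases n) auto
    have "rate m \<le> 10 + sqrt (5 * real n)"
    proof (cases "m < 20")
      case False
      then show ?thesis by (simp add: rate_def m)
    qed (simp add: rate_early)
    then show "(\<Sum>t<n. rate_step t) \<le> 10 + sqrt (5 * real n)"
      unfolding m sum_rate_step .
  qed
  also have "\<dots> = 10 * adv_width + 2 * (sqrt (5 * real n) * adv_width)"
    by (simp add: algebra_simps)
  \<comment> \<open>The computation yields 10 and 2; the stated constants 15 and 4 leave
    slack.\<close>
  also have "\<dots> \<le> 15 * adv_width + 4 * (sqrt (5 * real n) * adv_width)"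
    using adv_width_nonneg by (intro add_mono mult_right_mono mult_nonneg_nonneg) auto
  finally show ?thesis .
qed

end

section \<open>Nodes of nonzero gap and the logarithmic sum\<close>

locale gapped_tree = weighted_tree G L R for G :: "'v rtree" and L R +
  fixes \<Delta> :: "'v \<Rightarrow> real"
  assumes \<Delta>_nonneg: "a \<in> leaves G \<Longrightarrow> 0 \<le> \<Delta> a"
    and unique_best: "card {a \<in> leaves G. \<Delta> a = 0} \<le> 1"
begin

definition gap :: "'v \<Rightarrow> real" where
  "gap v = Min (\<Delta> ` leaves_below G v)"

definition sto_width :: real where
  "sto_width = (\<Sum>j=1..L. R j * sqrt (Gam G j \<Delta>))"

definition subopt :: "nat \<Rightarrow> 'v set" where
  "subopt j = {v \<in> level G j. gap v \<noteq> 0}"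

definition subopt_ent :: "('v \<Rightarrow> real) \<Rightarrow> real" where
  "subopt_ent p = (\<Sum>j=1..L. R j * (\<Sum>v\<in>subopt j. sqrt (mass G p v)))"

lemma gap_le: "v \<in> verts G \<Longrightarrow> a \<in> leaves_below G v \<Longrightarrow> gap v \<le> \<Delta> a"
  unfolding gap_def by simp

lemma gap_attained: "v \<in> verts G \<Longrightarrow> \<exists>a\<in>leaves_below G v. \<Delta> a = gap v"
  unfolding gap_def using Min_in[of "\<Delta> ` leaves_below G v"] leaves_below_nonempty[of v]
  by (metis (no_types, lifting) finite_imageI finite_leaves_below image_iff image_is_empty)

lemma gap_nonneg:
  assumes "v \<in> verts G"
  shows "0 \<le> gap v"
proof -
  obtain a where "a \<in> leaves_below G v" "\<Delta> a = gap v" using gap_attained[OF assms] by blast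
  with \<Delta>_nonneg[of a] show ?thesis by (simp add: leaves_below_def)
qed

text \<open>A node of gap zero has a leaf of gap zero below it, since the minimum is attained. There
  is at most one such leaf, and it lies below only one node of the level.\<close>

lemma level_cases:
  obtains (all) "level G j = subopt j"
  | (except) v where "v \<in> level G j" "subopt j = level G j - {v}"
proof (cases "\<exists>v\<in>level G j. gap v = 0")
  case True
  then obtain v where v: "v \<in> level G j" "gap v = 0" by blast
  have "u = v" if u: "u \<in> level G j" "gap u = 0" for u
  proof -
    have "v \<in> verts G" "u \<in> verts G" using u v by (simp_all add: level_def)
    then obtain a b where a: "a \<in> leaves_below G v" "\<Delta> a = 0" and b: "b \<in> leaves_below G u" "\<Delta> b = 0"
      using gap_attained u(2) v(2) by metis
    have "\<forall>a\<in>{a \<in> leaves G. \<Delta> a = 0}. \<forall>b\<in>{a \<in> leaves G. \<Delta> a = 0}. a = b"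
      using unique_best by (subst card_le_Suc0_iff_eq[symmetric]) simp_all
    moreover have "a \<in> leaves G" "b \<in> leaves G" using a b by (simp_all add: leaves_below_def)
    ultimately have "a = b" using a b by simp
    then show "u = v" using a b u v by (simp add: leaves_below_eq)
  qed
  then have "subopt j = level G j - {v}" using v unfolding subopt_def by blast
  with v(1) show ?thesis by (rule except)
next
  case False
  then show ?thesis by (intro all) (simp add: subopt_def set_eq_iff, blast)
qed

lemma finite_subopt [simp]: "finite (subopt j)"
  by (simp add: subopt_def)

text \<open>The \<open>R j\<close> subtracted on a level pays for its single node of gap zero, if
  there is one, as the root of its mass is at most 1.\<close>

lemma ent_gap_le_subopt:
  assumes p: "p \<in> prob_simplex G"
  shows "ent_gap p \<le> subopt_ent p"
proof -
  have "(\<Sum>v\<in>level G j. sqrt (mass G p v)) - 1 \<le> (\<Sum>v\<in>subopt j. sqrt (mass G p v))" for j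
  proof (cases rule: level_cases[of j])
    case (except v)
    then show ?thesis
      using mass_le_1[OF p, of v] by (simp add: sum_diff1)
  qed auto
  then have "(\<Sum>j=1..L. R j * ((\<Sum>v\<in>level G j. sqrt (mass G p v)) - 1)) \<le> subopt_ent p"
    unfolding subopt_ent_def using R_pos by (intro sum_mono mult_left_mono) (auto intro: less_imp_le)
  then show ?thesis
    by (simp add: ent_gap_def ent_def sum_weight_nonroot right_diff_distrib sum_subtractf)
qed

text \<open>For the excluded node \<open>1 - m\<close> is the total mass of the other nodes of its
  level, which is at most the sum of their square roots. Those nodes are therefore counted
  twice.\<close>

lemma spread_le_subopt:
  assumes p: "p \<in> prob_simplex G"
  shows "spread p \<le> 2 * subopt_ent p"
proof -
  let ?m = "mass G p"
  have m: "0 \<le> ?m v" "?m v \<le> 1" for v using mass_nonneg[OF p] mass_le_1[OF p] by auto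
  have sq: "sqrt (?m v) * (1 - ?m v) \<le> sqrt (?m v)" for v
    using m[of v] by (intro mult_left_le) auto
  have "(\<Sum>v\<in>level G j. sqrt (?m v) * (1 - ?m v)) \<le> 2 * (\<Sum>v\<in>subopt j. sqrt (?m v))"
    if j: "j \<le> L" for j
  proof (cases rule: level_cases[of j])
    case all
    have "(\<Sum>v\<in>subopt j. sqrt (?m v) * (1 - ?m v)) \<le> (\<Sum>v\<in>subopt j. sqrt (?m v))"
      by (intro sum_mono sq)
    moreover have "0 \<le> (\<Sum>v\<in>subopt j. sqrt (?m v))" using m by (intro sum_nonneg) auto
    ultimately show ?thesis unfolding all by simp
  next
    case (except v)
    have "sqrt (?m v) * (1 - ?m v) \<le> 1 - ?m v"
      using m[of v] mult_right_mono[of "sqrt (?m v)" 1 "1 - ?m v"] by simp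
    also have "\<dots> = (\<Sum>u\<in>subopt j. ?m u)"
      using except sum_level_simplex[OF p j] by (simp add: sum_diff1)
    also have "\<dots> \<le> (\<Sum>u\<in>subopt j. sqrt (?m u))"
    proof (rule sum_mono)
      fix u
      show "?m u \<le> sqrt (?m u)"
        using m[of u] mult_left_le[of "sqrt (?m u)" "sqrt (?m u)"] by simp
    qed
    finally have "sqrt (?m v) * (1 - ?m v) \<le> (\<Sum>u\<in>subopt j. sqrt (?m u))" .
    moreover have "(\<Sum>u\<in>subopt j. sqrt (?m u) * (1 - ?m u)) \<le> (\<Sum>u\<in>subopt j. sqrt (?m u))"
      by (intro sum_mono sq)
    ultimately show ?thesis
      using except by (simp add: sum.remove[of "level G j" v])
  qed
  then show ?thesis
    unfolding spread_def sum_weight_nonroot subopt_ent_def sum_distrib_left[of 2] mult.left_commute[of 2]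
    using R_pos by (intro sum_mono mult_left_mono) (auto intro: less_imp_le)
qed

lemma Gam_nonneg: "0 \<le> Gam G j \<Delta>"
  unfolding Gam_def gap_def[symmetric]
  using gap_nonneg by (intro sum_nonneg) (auto simp: level_def)

lemma pairing_gap_nonneg: "p \<in> prob_simplex G \<Longrightarrow> 0 \<le> pairing \<Delta> p"
  unfolding pairing_def using \<Delta>_nonneg simplex_nonneg by (intro sum_nonneg mult_nonneg_nonneg)

text \<open>The gap of a node underestimates that of every leaf below it, and the subtrees of a
  level partition the leaves.\<close>

lemma sum_gap_mass_le:
  assumes p: "p \<in> prob_simplex G" and j: "j \<le> L"
  shows "(\<Sum>v\<in>subopt j. gap v * mass G p v) \<le> pairing \<Delta> p"
proof -
  have "(\<Sum>v\<in>subopt j. gap v * mass G p v) \<le> (\<Sum>v\<in>level G j. gap v * mass G p v)"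
    using gap_nonneg mass_nonneg[OF p]
    by (intro sum_mono2) (auto simp: subopt_def level_def)
  also have "\<dots> \<le> (\<Sum>v\<in>level G j. mass G (\<lambda>a. \<Delta> a * p a) v)"
    unfolding mass_def sum_distrib_left using simplex_nonneg[OF p]
    by (intro sum_mono mult_right_mono gap_le) (auto simp: leaves_below_def level_def)
  also have "\<dots> = pairing \<Delta> p"
    using j by (simp add: sum_level_mass pairing_def)
  finally show ?thesis .
qed

text \<open>Cauchy-Schwarz on each level, with \<open>sqrt m\<close> split as
  \<open>sqrt (1 / gap) * sqrt (gap * m)\<close>: the first factors give \<open>Gam\<close>, the
  second at most the expected gap, whatever the level.\<close>

lemma subopt_ent_le:
  assumes p: "p \<in> prob_simplex G"
  shows "subopt_ent p \<le> sto_width * sqrt (pairing \<Delta> p)"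
  unfolding subopt_ent_def sto_width_def sum_distrib_right mult.assoc
proof (intro sum_mono mult_left_mono)
  fix j assume j: "j \<in> {1..L}"
  have g: "0 < gap v" if "v \<in> subopt j" for v
    using that gap_nonneg[of v] by (auto simp: subopt_def level_def less_le)
  have "(\<Sum>v\<in>subopt j. sqrt (mass G p v)) = (\<Sum>v\<in>subopt j. sqrt (1 / gap v) * sqrt (gap v * mass G p v))"
    by (intro sum.cong refl) (use g in \<open>force simp flip: real_sqrt_mult\<close>)
  moreover have "(\<Sum>v\<in>subopt j. sqrt (1 / gap v) * sqrt (gap v * mass G p v))\<^sup>2
     \<le> (\<Sum>v\<in>subopt j. (sqrt (1 / gap v))\<^sup>2) * (\<Sum>v\<in>subopt j. (sqrt (gap v * mass G p v))\<^sup>2)"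
    by (rule Cauchy_Schwarz_ineq_sum)
  moreover have "(\<Sum>v\<in>subopt j. (sqrt (1 / gap v))\<^sup>2) = Gam G j \<Delta>"
    unfolding Gam_def gap_def[symmetric] subopt_def[symmetric]
    using g by (intro sum.cong refl) (simp add: less_imp_le)
  moreover have "(\<Sum>v\<in>subopt j. (sqrt (gap v * mass G p v))\<^sup>2) = (\<Sum>v\<in>subopt j. gap v * mass G p v)"
    using g mass_nonneg[OF p] by (intro sum.cong refl) (simp add: less_imp_le)
  moreover have "Gam G j \<Delta> * (\<Sum>v\<in>subopt j. gap v * mass G p v) \<le> Gam G j \<Delta> * pairing \<Delta> p"
    using j by (intro mult_left_mono sum_gap_mass_le p Gam_nonneg) auto
  ultimately have "(\<Sum>v\<in>subopt j. sqrt (mass G p v))\<^sup>2 \<le> Gam G j \<Delta> * pairing \<Delta> p"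
    by simp
  then show "(\<Sum>v\<in>subopt j. sqrt (mass G p v)) \<le> sqrt (Gam G j \<Delta>) * sqrt (pairing \<Delta> p)"
    unfolding real_sqrt_mult[symmetric] by (rule real_le_rsqrt)
qed (use R_pos in \<open>auto intro: less_imp_le\<close>)

text \<open>During the plateau the rate is 10, so the worst-case bound with
  \<open>5 / 2 / 10 = 1/4\<close> is used. Later both parts of the round bound are at most
  \<open>sqrt 5 / sqrt (t + 1)\<close> times \<open>subopt_ent\<close>.\<close>

lemma round_bound_stochastic:
  assumes p: "p \<in> prob_simplex G"
  shows "2 * round_bound t p - pairing \<Delta> p
    \<le> 2 * adv_width * (if t < 20 then 1 / 4 + rate_step t else 0)
      + 20 * sto_width\<^sup>2 * (if t < 20 then 0 else 1 / (real t + 1))"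
proof (cases "t < 20")
  case True
  with round_bound_le[OF p, of t] pairing_gap_nonneg[OF p] show ?thesis
    by (simp add: rate_early algebra_simps)
next
  case False
  let ?D = "pairing \<Delta> p" and ?W = "subopt_ent p" and ?s = "sqrt (real t + 1)"
  have D: "0 \<le> ?D" by (rule pairing_gap_nonneg[OF p])
  have W: "0 \<le> ?W"
    unfolding subopt_ent_def using R_pos mass_nonneg[OF p]
    by (intro sum_nonneg mult_nonneg_nonneg) (auto intro: less_imp_le)
  have "5 / 2 / rate t * spread p \<le> 5 / 2 / rate t * (2 * ?W)"
    using rate_ge_10[of t] by (intro mult_left_mono spread_le_subopt p) auto
  also have "\<dots> = sqrt 5 / ?s * ?W"
    using False by (simp add: rate_late field_simps)
  finally have 1: "5 / 2 / rate t * spread p \<le> sqrt 5 / ?s * ?W" .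
  have "rate_step t * ent_gap p \<le> rate_step t * ?W"
    by (intro mult_left_mono ent_gap_le_subopt p rate_step_nonneg)
  also have "\<dots> \<le> sqrt 5 / ?s * ?W"
    using False W by (intro mult_right_mono rate_step_late) auto
  finally have "2 * round_bound t p \<le> 4 * (sqrt 5 / ?s * ?W)"
    using 1 by (simp add: round_bound_def)
  also have "\<dots> \<le> 4 * (sqrt 5 / ?s * (sto_width * sqrt ?D))"
    by (intro mult_left_mono subopt_ent_le p) auto
  \<comment> \<open>Split for \<open>2 * x * y \<le> x\<^sup>2 + y\<^sup>2\<close> with
    \<open>y = sqrt ?D\<close>: then \<open>y\<^sup>2\<close> is the gap term to be subtracted, and
    \<open>x\<^sup>2\<close> carries the constant \<open>2\<^sup>2 * 5 = 20\<close>.\<close>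
  also have "\<dots> = 2 * (2 * (sqrt 5 / ?s) * sto_width) * sqrt ?D" by simp
  also have "\<dots> \<le> (2 * (sqrt 5 / ?s) * sto_width)\<^sup>2 + (sqrt ?D)\<^sup>2"
    by (rule sum_squares_bound)
  also have "\<dots> = 20 * sto_width\<^sup>2 * (1 / (real t + 1)) + ?D"
    using D by (simp add: power_mult_distrib power_divide)
  finally show ?thesis using False by simp
qed

lemma stochastic_bound:
  assumes n: "1 \<le> n" and P: "\<And>t. t < n \<Longrightarrow> P t \<in> prob_simplex G"
  shows "2 * (\<Sum>t<n. round_bound t (P t)) - (\<Sum>t<n. pairing \<Delta> (P t))
     \<le> 30 * adv_width + 20 * sto_width\<^sup>2 * ln (exp 1 * real n)"
proof -
  let ?e = "\<lambda>t. if t < 20 then 1 / 4 + rate_step t else 0"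
  have "2 * (\<Sum>t<n. round_bound t (P t)) - (\<Sum>t<n. pairing \<Delta> (P t))
    \<le> (\<Sum>t<n. 2 * adv_width * ?e t + 20 * sto_width\<^sup>2 * (if t < 20 then 0 else 1 / (real t + 1)))"
    unfolding sum_distrib_left sum_subtractf[symmetric]
    using P by (intro sum_mono round_bound_stochastic) auto
  also have "\<dots> = 2 * adv_width * (\<Sum>t<n. ?e t)
      + 20 * sto_width\<^sup>2 * (\<Sum>t<n. if t < 20 then 0 else 1 / (real t + 1))"
    by (simp only: sum.distrib sum_distrib_left)
  also have "\<dots> \<le> 2 * adv_width * 15 + 20 * sto_width\<^sup>2 * ln (exp 1 * real n)"
  proof (intro add_mono mult_left_mono)
    have "(\<Sum>t<n. ?e t) \<le> (\<Sum>t<Suc 19. 1 / 4 + rate_step t)"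
    proof -
      have "(\<Sum>t<n. ?e t) = (\<Sum>t\<in>{..<n} \<inter> {..<20}. 1 / 4 + rate_step t)"
        by (subst sum.inter_restrict) (auto intro!: sum.cong)
      also have "\<dots> \<le> (\<Sum>t<Suc 19. 1 / 4 + rate_step t)"
        using rate_step_nonneg by (intro sum_mono2) (auto intro: add_nonneg_nonneg)
      finally show ?thesis .
    qed
    \<comment> \<open>Twenty rounds of \<open>1/4\<close> plus the increments, which sum to
      \<open>rate 19 = 10\<close>. Doubling gives the constant 30.\<close>
    also have "\<dots> = 15"
      unfolding sum.distrib sum_rate_step by (simp add: rate_early)
    finally show "(\<Sum>t<n. ?e t) \<le> 15" .
    have "(\<Sum>t<n. if t < 20 then 0 else 1 / (real t + 1)) \<le> ln (real n)"
      by (rule sum_late_harmonic[OF n])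
    also have "\<dots> \<le> ln (exp 1 * real n)"
      using n by (simp add: ln_mult)
    finally show "(\<Sum>t<n. if t < 20 then 0 else 1 / (real t + 1)) \<le> ln (exp 1 * real n)" .
  qed (use adv_width_nonneg in auto)
  finally show ?thesis by simp
qed

end

section \<open>Measurability and expectations\<close>

text \<open>
  A function that is uniformly continuous in finitely many measurable coordinates is a continuous
  function of these coordinates on their range, which need not be a measurable set.
\<close>

lemma borel_measurable_of_coordinates:
  fixes Z :: "'h \<Rightarrow> 'a \<Rightarrow> real" and f :: "'h \<Rightarrow> real"
  assumes A: "finite A" and Z: "\<And>a. a \<in> A \<Longrightarrow> (\<lambda>h. Z h a) \<in> borel_measurable M"
    and bound: "\<And>h h'. h \<in> space M \<Longrightarrow> h' \<in> space M \<Longrightarrow>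
      (f h - f h')\<^sup>2 \<le> c * (\<Sum>a\<in>A. \<bar>Z h a - Z h' a\<bar>)"
  shows "f \<in> borel_measurable M"
proof -
  \<comment> \<open>Coordinates are renumbered by \<open>nat\<close>: for a countable index type,
    measurability into the function space can be checked coordinatewise.\<close>
  obtain e where e: "bij_betw e {0..<card A} A"
    using ex_bij_betw_nat_finite[OF A] by blast
  define Y where "Y h i = (if i < card A then Z h (e i) else 0)" for h and i :: nat
  define g where "g y = f (SOME h. h \<in> space M \<and> Y h = y)" for y
  have e_in: "e i \<in> A" if "i < card A" for i
    using bij_betwE[OF e] that by simp
  have "Y \<in> borel_measurable M"
    unfolding Y_def[abs_def]
  proof (intro measurable_coordinatewise_then_product)
    fix i
    show "(\<lambda>h. if i < card A then Z h (e i) else 0) \<in> borel_measurable M"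
    proof (cases "i < card A")
      case True
      then show ?thesis using Z[OF e_in[OF True]] by simp
    qed simp
  qed
  then have Y: "Y \<in> M \<rightarrow>\<^sub>M restrict_space borel (Y ` space M)"
    by (intro measurable_restrict_space2) auto
  have sum_Y: "(\<Sum>a\<in>A. \<bar>Z h a - Z h' a\<bar>) = (\<Sum>i<card A. \<bar>Y h i - Y h' i\<bar>)" for h h'
    by (subst sum.reindex_bij_betw[OF e, symmetric]) (auto simp: Y_def lessThan_atLeast0)
  have some: "(SOME h'. h' \<in> space M \<and> Y h' = Y h) \<in> space M \<and> Y (SOME h'. h' \<in> space M \<and> Y h' = Y h) = Y h"
    if "h \<in> space M" for h
    by (rule someI_ex) (use that in blast)
  have gbound: "(g y - g y')\<^sup>2 \<le> c * (\<Sum>i<card A. \<bar>y i - y' i\<bar>)"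
    if yy: "y \<in> Y ` space M" "y' \<in> Y ` space M" for y y'
  proof -
    obtain h h' where h: "h \<in> space M" "y = Y h" "h' \<in> space M" "y' = Y h'" using yy by auto
    show ?thesis
      using bound[OF conjunct1[OF some[OF h(1)]] conjunct1[OF some[OF h(3)]]]
        conjunct2[OF some[OF h(1)]] conjunct2[OF some[OF h(3)]]
      unfolding sum_Y g_def h by simp
  qed
  \<comment> \<open>The bound forces equal values of \<open>f\<close> at equal coordinates, so the
    representative chosen in \<open>g\<close> is immaterial.\<close>
  have gf: "g (Y h) = f h" if h: "h \<in> space M" for h
  proof -
    have "(f (SOME h'. h' \<in> space M \<and> Y h' = Y h) - f h)\<^sup>2 \<le> 0"
      using bound[OF conjunct1[OF some[OF h]] h] conjunct2[OF some[OF h]] unfolding sum_Y by simp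
    then show ?thesis by (simp add: g_def)
  qed
  have "continuous_on (Y ` space M) g"
    unfolding continuous_on_def
  proof
    fix y assume y: "y \<in> Y ` space M"
    have "continuous_on (Y ` space M) (\<lambda>y'. y' i)" for i
      by (rule continuous_on_subset[OF continuous_on_product_coordinates subset_UNIV])
    then have "((\<lambda>y'. y' i) \<longlongrightarrow> y i) (at y within Y ` space M)" for i
      using y unfolding continuous_on_def by blast
    then have "((\<lambda>y'. sqrt (c * (\<Sum>i<card A. \<bar>y' i - y i\<bar>))) \<longlongrightarrow> sqrt (c * (\<Sum>i<card A. \<bar>y i - y i\<bar>)))
      (at y within Y ` space M)"
      by (intro tendsto_intros)
    then have lim: "((\<lambda>y'. sqrt (c * (\<Sum>i<card A. \<bar>y' i - y i\<bar>))) \<longlongrightarrow> 0) (at y within Y ` space M)"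
      by simp
    have "\<bar>g y' - g y\<bar> \<le> sqrt (c * (\<Sum>i<card A. \<bar>y' i - y i\<bar>))" if "y' \<in> Y ` space M" for y'
      using gbound[OF that y] by (intro real_le_rsqrt) simp
    then have "eventually (\<lambda>y'. norm (g y' - g y) \<le> sqrt (c * (\<Sum>i<card A. \<bar>y' i - y i\<bar>))) (at y within Y ` space M)"
      by (auto simp: eventually_at_filter)
    then have "((\<lambda>y'. g y' - g y) \<longlongrightarrow> 0) (at y within Y ` space M)"
      by (rule Lim_null_comparison[OF _ lim])
    then show "(g \<longlongrightarrow> g y) (at y within Y ` space M)"
      by (simp add: LIM_zero_iff)
  qed
  then have "g \<in> borel_measurable (restrict_space borel (Y ` space M))"
    by (rule borel_measurable_continuous_on_restrict)
  with Y have "(\<lambda>h. g (Y h)) \<in> borel_measurable M" by (rule measurable_compose)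
  then show ?thesis
    by (rule measurable_cong[THEN iffD1, rotated]) (rule gf)
qed

context weighted_tree
begin

lemma space_round_space:
  assumes "r \<in> space (round_space G R)"
  shows "bounded_loss (fst r)" "snd r \<in> leaves G"
  using assms
  by (auto simp: round_space_def space_pair_measure loss_space_def space_PiM space_restrict_space
      bounded_loss_def weight_def PiE_iff)

lemma measurable_loss [measurable]: "v \<in> nonroot G \<Longrightarrow> (\<lambda>l. l v) \<in> borel_measurable (loss_space G R)"
proof -
  assume v: "v \<in> nonroot G"
  have "(\<lambda>l. l v) \<in> loss_space G R \<rightarrow>\<^sub>M restrict_space borel {x. 0 \<le> x \<and> x \<le> 1 \<and> x \<le> R (depth G v)}"
    unfolding loss_space_def using v by (rule measurable_component_singleton)
  then show ?thesis by (simp add: measurable_restrict_space2_iff)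
qed

text \<open>The action takes finitely many values, so joint measurability can be checked with the
  action held fixed.\<close>

lemma measurable_round:
  fixes F :: "'h \<Rightarrow> ('v \<Rightarrow> real) \<Rightarrow> 'v \<Rightarrow> real"
  assumes "\<And>A. A \<in> leaves G \<Longrightarrow>
    (\<lambda>x. F (fst x) (fst (snd x)) A) \<in> borel_measurable (H \<Otimes>\<^sub>M round_space G R)"
  shows "(\<lambda>x. F (fst x) (fst (snd x)) (snd (snd x))) \<in> borel_measurable (H \<Otimes>\<^sub>M round_space G R)"
proof (rule measurable_compose_countable'[where I = "leaves G" and g = "\<lambda>x. snd (snd x)"])
  show "(\<lambda>x. snd (snd x)) \<in> H \<Otimes>\<^sub>M round_space G R \<rightarrow>\<^sub>M count_space (leaves G)"
    unfolding round_space_def by measurable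
qed (auto intro: assms countable_finite)

lemma measurable_round_loss [measurable]:
  "v \<in> nonroot G \<Longrightarrow> (\<lambda>x. fst (snd x) v) \<in> borel_measurable (H \<Otimes>\<^sub>M round_space G R)"
  unfolding round_space_def
  by (rule measurable_compose[OF _ measurable_loss]) measurable

lemma measurable_past_mass:
  assumes "\<And>a. a \<in> leaves G \<Longrightarrow> (\<lambda>h. q h a) \<in> borel_measurable H"
  shows "(\<lambda>h. mass G (q h) v) \<in> borel_measurable H"
  unfolding mass_def using assms by (intro borel_measurable_sum) (auto simp: leaves_below_def)

lemma measurable_action_loss:
  "(\<lambda>x. action_loss G (fst (snd x)) (snd (snd x))) \<in> borel_measurable (H \<Otimes>\<^sub>M round_space G R)"
  "(\<lambda>x. action_loss G (fst (snd x)) a) \<in> borel_measurable (H \<Otimes>\<^sub>M round_space G R)"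
proof -
  show *: "(\<lambda>x. action_loss G (fst (snd x)) a) \<in> borel_measurable (H \<Otimes>\<^sub>M round_space G R)" for a
    unfolding action_loss_def by (intro borel_measurable_sum measurable_round_loss) (auto simp: path_def)
  show "(\<lambda>x. action_loss G (fst (snd x)) (snd (snd x))) \<in> borel_measurable (H \<Otimes>\<^sub>M round_space G R)"
    by (rule measurable_round[where F = "\<lambda>_. action_loss G"]) (rule *)
qed

lemma measurable_loss_estimate:
  assumes q: "\<And>a. a \<in> leaves G \<Longrightarrow> (\<lambda>h. q h a) \<in> borel_measurable H"
  shows "(\<lambda>x. loss_estimate G (q (fst x)) (snd x) a) \<in> borel_measurable (H \<Otimes>\<^sub>M round_space G R)"
proof -
  note [measurable] = measurable_past_mass[OF q]
  have "(\<lambda>x. loss_estimate G (q (fst x)) (fst (snd x), A) a) \<in> borel_measurable (H \<Otimes>\<^sub>M round_space G R)" for A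
    unfolding loss_estimate_def fst_conv snd_conv
    by (intro borel_measurable_sum borel_measurable_times borel_measurable_divide measurable_const
        measurable_round_loss) (auto simp: path_def)
  from measurable_round[where F = "\<lambda>h l A. loss_estimate G (q h) (l, A) a", OF this] show ?thesis by simp
qed

lemma measurable_stab:
  assumes q: "\<And>a. a \<in> leaves G \<Longrightarrow> (\<lambda>h. q h a) \<in> borel_measurable H"
  shows "(\<lambda>x. stab b (q (fst x)) (snd x)) \<in> borel_measurable (H \<Otimes>\<^sub>M round_space G R)"
proof -
  note [measurable] = measurable_past_mass[OF q]
  have "(\<lambda>x. stab b (q (fst x)) (fst (snd x), A)) \<in> borel_measurable (H \<Otimes>\<^sub>M round_space G R)"
    if A: "A \<in> leaves G" for A
  proof -
    have "proj (depth G v) A \<in> nonroot G" if "v \<in> nonroot G" for v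
      using proj_in_level[OF A] level_subset_nonroot depth_nonroot[OF that] by force
    note [measurable] = measurable_round_loss[OF this]
    show ?thesis
      unfolding stab_def centered_def fst_conv snd_conv by measurable
  qed
  from measurable_round[where F = "\<lambda>h l A. stab b (q h) (l, A)", OF this] show ?thesis by simp
qed

lemma measurable_past:
  assumes "t < T"
  shows "(\<lambda>h. (restrict h {0..<t}, h t)) \<in> history_space G R T \<rightarrow>\<^sub>M history_space G R t \<Otimes>\<^sub>M round_space G R"
  unfolding history_space_def using assms
  by (intro measurable_Pair measurable_restrict_subset measurable_component_singleton) auto

end

section \<open>The law of the game and conditional expectations\<close>

locale tree_game = weighted_tree G L R for G :: "'v rtree" and L R +
  fixes env :: "'v env" and p :: "'v strategy"
  assumes env: "environment G R env" and learner: "learner G R p"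
begin

lemma strategy_simplex: "h \<in> space (history_space G R n) \<Longrightarrow> p n h \<in> prob_simplex G"
  and measurable_strategy [measurable]: "a \<in> leaves G \<Longrightarrow> (\<lambda>h. p n h a) \<in> borel_measurable (history_space G R n)"
  using learner unfolding learner_def by blast+

lemma measurable_action:
  "(\<lambda>h. point_measure (leaves G) (\<lambda>a. ennreal (p n h a))) \<in>
     history_space G R n \<rightarrow>\<^sub>M prob_algebra (count_space (leaves G))"
proof (intro measurable_prob_algebraI measurable_subprob_algebra)
  fix h assume h: "h \<in> space (history_space G R n)"
  show "prob_space (point_measure (leaves G) (\<lambda>a. ennreal (p n h a)))"
    using strategy_simplex[OF h]
    by (intro prob_spaceI)
       (simp add: space_point_measure emeasure_point_measure_finite sum_ennreal simplex_nonneg simplex_sum)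
  then show "subprob_space (point_measure (leaves G) (\<lambda>a. ennreal (p n h a)))"
    by (rule prob_space_imp_subprob_space)
  show "sets (point_measure (leaves G) (\<lambda>a. ennreal (p n h a))) = sets (count_space (leaves G))"
    by (simp add: sets_point_measure)
next
  fix X assume "X \<in> sets (count_space (leaves G))"
  then have X: "X \<subseteq> leaves G" by simp
  then show "(\<lambda>h. emeasure (point_measure (leaves G) (\<lambda>a. ennreal (p n h a))) X)
      \<in> borel_measurable (history_space G R n)"
    by (subst emeasure_point_measure_finite)
       (auto intro!: borel_measurable_sum measurable_compose[OF measurable_strategy measurable_ennreal])
qed

lemma measurable_round_law:
  "round_law G env p n \<in> history_space G R n \<rightarrow>\<^sub>M prob_algebra (round_space G R)"
  unfolding round_law_def[abs_def] round_space_def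
  using env by (intro measurable_pair_prob measurable_action) (simp add: environment_def)

sublocale IT: Ionescu_Tulcea "round_law G env p" "\<lambda>_. round_space G R"
proof (rule Ionescu_Tulcea.intro)
  fix n
  have *: "round_law G env p n \<in> Pi\<^sub>M {0..<n} (\<lambda>_. round_space G R) \<rightarrow>\<^sub>M prob_algebra (round_space G R)"
    using measurable_round_law[of n] by (simp only: history_space_def)
  then show "round_law G env p n \<in> Pi\<^sub>M {0..<n} (\<lambda>_. round_space G R) \<rightarrow>\<^sub>M subprob_algebra (round_space G R)"
    by (rule measurable_prob_algebraD)
  fix h assume "h \<in> space (Pi\<^sub>M {0..<n} (\<lambda>_. round_space G R))"
  from measurable_space[OF * this] show "prob_space (round_law G env p n h)"
    by (simp add: space_prob_algebra)
qed

lemma sets_env: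
  assumes "h \<in> space (history_space G R n)"
  shows "sets (env n h) = sets (loss_space G R)"
proof -
  have "env n \<in> history_space G R n \<rightarrow>\<^sub>M prob_algebra (loss_space G R)"
    using env by (simp add: environment_def)
  from measurable_space[OF this assms] show ?thesis by (simp add: space_prob_algebra)
qed

lemma nn_integral_round_law:
  assumes h: "h \<in> space (history_space G R n)" and g: "g \<in> borel_measurable (round_space G R)"
  shows "(\<integral>\<^sup>+r. g r \<partial>round_law G env p n h) = (\<integral>\<^sup>+l. (\<Sum>a\<in>leaves G. ennreal (p n h a) * g (l, a)) \<partial>env n h)"
proof -
  have "point_measure (leaves G) (\<lambda>a. ennreal (p n h a)) \<in> space (prob_algebra (count_space (leaves G)))"
    by (rule measurable_space[OF measurable_action h])
  then interpret A: prob_space "point_measure (leaves G) (\<lambda>a. ennreal (p n h a))"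
    by (simp add: space_prob_algebra)
  note sets_env[OF h]
  with g have "g \<in> borel_measurable (env n h \<Otimes>\<^sub>M point_measure (leaves G) (\<lambda>a. ennreal (p n h a)))"
    unfolding round_space_def
    by (subst measurable_cong_sets[OF sets_pair_measure_cong refl]) (auto simp: sets_point_measure)
  then show ?thesis
    unfolding round_law_def by (simp add: A.nn_integral_fst[symmetric] nn_integral_point_measure_finite)
qed

lemma sets_play: "sets (play G R env p T) = sets (history_space G R T)"
  and space_play: "space (play G R env p T) = space (history_space G R T)"
  and prob_space_play: "prob_space (play G R env p T)"
  unfolding play_def history_space_def
  using IT.sets_C[of _ 0 T] IT.space_C[of _ 0 T] IT.prob_space_C[of _ 0 T] by (simp_all add: space_PiM)

lemma past_in_space:
  assumes "h \<in> space (play G R env p T)" "t < T"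
  shows "restrict h {0..<t} \<in> space (history_space G R t)" "h t \<in> space (round_space G R)"
  using measurable_space[OF measurable_past[OF assms(2)], of h] assms(1)
  by (auto simp: space_play space_pair_measure)

text \<open>The tower rule for round \<open>t\<close>: later rounds are marginalized away, and the
  last kernel is integrated given the past, first over the finitely many actions and then over the
  loss.\<close>

lemma nn_integral_play:
  assumes t: "t < T" and g: "case_prod g \<in> borel_measurable (history_space G R t \<Otimes>\<^sub>M round_space G R)"
  shows "(\<integral>\<^sup>+h. g (restrict h {0..<t}) (h t) \<partial>play G R env p T) =
    (\<integral>\<^sup>+h. \<integral>\<^sup>+l. (\<Sum>a\<in>leaves G. ennreal (p t h a) * g h (l, a)) \<partial>env t h \<partial>play G R env p t)"
proof -
  let ?u = "\<lambda>_. undefined" and ?f = "\<lambda>h. g (restrict h {0..<t}) (h t)"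
  have u: "?u \<in> space (Pi\<^sub>M {0..<0::nat} (\<lambda>_. round_space G R))" by (auto simp: space_PiM)
  have f: "?f \<in> borel_measurable (Pi\<^sub>M {0..<Suc t} (\<lambda>_. round_space G R))"
    using measurable_compose[OF measurable_past[of t "Suc t"] g] by (simp add: history_space_def)
  \<comment> \<open>The integrand depends on the first \<open>t + 1\<close> rounds only, and their
    law is a marginal of the law of all \<open>T\<close> rounds.\<close>
  have "(\<integral>\<^sup>+h. ?f h \<partial>play G R env p T) = (\<integral>\<^sup>+h. ?f (restrict h {0..<0 + Suc t}) \<partial>IT.C 0 T ?u)"
    unfolding play_def by (intro nn_integral_cong) (simp add: Int_absorb2 Int_absorb1 restrict_restrict)
  also have "\<dots> = (\<integral>\<^sup>+h. ?f h \<partial>IT.C 0 (Suc t) ?u)"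
    using t f u by (intro IT.nn_integral_C[symmetric]) auto
  also have "\<dots> = (\<integral>\<^sup>+h. (\<integral>\<^sup>+h'. ?f h' \<partial>IT.eP t h) \<partial>IT.C 0 t ?u)"
    using IT.measurable_eP[of t] IT.sets_C[OF u, of t]
    by (simp, subst nn_integral_bind[OF f]) (auto cong: measurable_cong_sets)
  also have "\<dots> = (\<integral>\<^sup>+h. (\<integral>\<^sup>+r. g h r \<partial>round_law G env p t h) \<partial>IT.C 0 t ?u)"
  proof (intro nn_integral_cong)
    fix h assume "h \<in> space (IT.C 0 t ?u)"
    then have h: "h \<in> space (Pi\<^sub>M {0..<t} (\<lambda>_. round_space G R))"
      using IT.space_C[OF u, of t] by simp
    have "restrict (h(t := r)) {0..<t} = h" for r
      using h by (auto simp: space_PiM PiE_def extensional_def restrict_def)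
    then show "(\<integral>\<^sup>+h'. ?f h' \<partial>IT.eP t h) = (\<integral>\<^sup>+r. g h r \<partial>round_law G env p t h)"
      by (subst IT.nn_integral_eP[OF h f]) simp
  qed
  also have "\<dots> = (\<integral>\<^sup>+h. \<integral>\<^sup>+l. (\<Sum>a\<in>leaves G. ennreal (p t h a) * g h (l, a)) \<partial>env t h \<partial>play G R env p t)"
    unfolding play_def
  proof (intro nn_integral_cong nn_integral_round_law)
    fix h assume "h \<in> space (IT.C 0 t ?u)"
    then show h: "h \<in> space (history_space G R t)"
      using IT.space_C[OF u, of t] by (simp add: history_space_def)
    show "g h \<in> borel_measurable (round_space G R)"
      using measurable_compose[OF measurable_Pair1'[OF h] g] by simp
  qed
  finally show ?thesis .
qed

lemma integrable_play_bounded: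
  assumes t: "t < T" and g: "case_prod g \<in> borel_measurable (history_space G R t \<Otimes>\<^sub>M round_space G R)"
    and B: "\<And>h r. h \<in> space (history_space G R t) \<Longrightarrow> r \<in> space (round_space G R) \<Longrightarrow> \<bar>g h r\<bar> \<le> (B :: real)"
  shows "integrable (play G R env p T) (\<lambda>h. g (restrict h {0..<t}) (h t))"
proof -
  interpret prob_space "play G R env p T" by (rule prob_space_play)
  have "(\<lambda>h. g (restrict h {0..<t}) (h t)) \<in> borel_measurable (play G R env p T)"
    using measurable_compose[OF measurable_past[OF t] g] by (simp add: measurable_cong_sets[OF sets_play refl])
  then show ?thesis
    using past_in_space[OF _ t] by (intro integrable_const_bound[where B = B]) (auto intro!: AE_I2 B)
qed

text \<open>
  Since \<open>g\<close> is nonnegative, comparing conditional expectations round by round also yields its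
  integrability; the importance weighted estimates are not bounded a priori.
\<close>

lemma expectation_mono:
  fixes g g' :: "'v history \<Rightarrow> 'v round \<Rightarrow> real"
  assumes t: "t < T"
    and g: "case_prod g \<in> borel_measurable (history_space G R t \<Otimes>\<^sub>M round_space G R)"
    and g': "case_prod g' \<in> borel_measurable (history_space G R t \<Otimes>\<^sub>M round_space G R)"
    and g_nonneg: "\<And>h r. h \<in> space (history_space G R t) \<Longrightarrow> r \<in> space (round_space G R) \<Longrightarrow> 0 \<le> g h r"
    and g'_bounds: "\<And>h r. h \<in> space (history_space G R t) \<Longrightarrow> r \<in> space (round_space G R) \<Longrightarrow> 0 \<le> g' h r \<and> g' h r \<le> B"
    and le: "\<And>h l. h \<in> space (history_space G R t) \<Longrightarrow> bounded_loss l \<Longrightarrow>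
      (\<Sum>a\<in>leaves G. p t h a * g h (l, a)) \<le> (\<Sum>a\<in>leaves G. p t h a * g' h (l, a))"
  shows "integrable (play G R env p T) (\<lambda>h. g (restrict h {0..<t}) (h t))" (is ?int)
    and "integrable (play G R env p T) (\<lambda>h. g' (restrict h {0..<t}) (h t))"
    and "(\<integral>h. g (restrict h {0..<t}) (h t) \<partial>play G R env p T) \<le>
         (\<integral>h. g' (restrict h {0..<t}) (h t) \<partial>play G R env p T)" (is ?le)
proof -
  let ?M = "play G R env p T"
  let ?g = "\<lambda>h. g (restrict h {0..<t}) (h t)" and ?g' = "\<lambda>h. g' (restrict h {0..<t}) (h t)"
  have "(\<integral>\<^sup>+h. ennreal (?g h) \<partial>?M) = (\<integral>\<^sup>+h. \<integral>\<^sup>+l. (\<Sum>a\<in>leaves G. ennreal (p t h a) * ennreal (g h (l, a))) \<partial>env t h \<partial>play G R env p t)"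
    using g by (intro nn_integral_play t) (simp add: case_prod_beta')
  also have "\<dots> \<le> (\<integral>\<^sup>+h. \<integral>\<^sup>+l. (\<Sum>a\<in>leaves G. ennreal (p t h a) * ennreal (g' h (l, a))) \<partial>env t h \<partial>play G R env p t)"
  proof (intro nn_integral_mono)
    fix h l assume "h \<in> space (play G R env p t)" and l: "l \<in> space (env t h)"
    then have h: "h \<in> space (history_space G R t)" by (simp add: space_play)
    have "l \<in> space (loss_space G R)" using l sets_eq_imp_space_eq[OF sets_env[OF h]] by simp
    then have r: "(l, a) \<in> space (round_space G R)" if "a \<in> leaves G" for a
      using that by (simp add: round_space_def space_pair_measure)
    have bl: "bounded_loss l"
      using leaves_nonempty space_round_space(1)[OF r] by auto
    have "(\<Sum>a\<in>leaves G. ennreal (p t h a) * ennreal (g h (l, a))) = ennreal (\<Sum>a\<in>leaves G. p t h a * g h (l, a))"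
      using g_nonneg[OF h r] simplex_nonneg[OF strategy_simplex[OF h]]
      by (subst sum_ennreal[symmetric]) (auto simp: ennreal_mult)
    also have "\<dots> \<le> ennreal (\<Sum>a\<in>leaves G. p t h a * g' h (l, a))"
      by (intro ennreal_leI le h bl)
    also have "\<dots> = (\<Sum>a\<in>leaves G. ennreal (p t h a) * ennreal (g' h (l, a)))"
      using g'_bounds[OF h r] simplex_nonneg[OF strategy_simplex[OF h]]
      by (subst sum_ennreal[symmetric]) (auto simp: ennreal_mult)
    finally show "(\<Sum>a\<in>leaves G. ennreal (p t h a) * ennreal (g h (l, a)))
       \<le> (\<Sum>a\<in>leaves G. ennreal (p t h a) * ennreal (g' h (l, a)))" .
  qed
  also have "\<dots> = (\<integral>\<^sup>+h. ennreal (?g' h) \<partial>?M)"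
    using g' by (intro nn_integral_play[symmetric] t) (simp add: case_prod_beta')
  finally have nn: "(\<integral>\<^sup>+h. ennreal (?g h) \<partial>?M) \<le> (\<integral>\<^sup>+h. ennreal (?g' h) \<partial>?M)" .
  have pos: "AE h in ?M. 0 \<le> ?g h" "AE h in ?M. 0 \<le> ?g' h"
    using g_nonneg g'_bounds past_in_space[OF _ t] by (auto intro!: AE_I2)
  have int': "integrable ?M ?g'"
    using g'_bounds by (intro integrable_play_bounded[where B = B] t g') fastforce
  then show "integrable ?M ?g'" .
  have meas: "?g \<in> borel_measurable ?M"
    using measurable_compose[OF measurable_past[OF t] g] by (simp add: measurable_cong_sets[OF sets_play refl])
  have eq': "(\<integral>\<^sup>+h. ennreal (?g' h) \<partial>?M) = ennreal (\<integral>h. ?g' h \<partial>?M)"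
    by (rule nn_integral_eq_integral[OF int' pos(2)])
  with nn have "(\<integral>\<^sup>+h. ennreal (?g h) \<partial>?M) < \<infinity>"
    by (simp add: le_less_trans)
  with meas pos(1) show int: ?int by (intro integrableI_nonneg)
  show ?le
    using nn unfolding eq' nn_integral_eq_integral[OF int pos(1)]
    by (subst (asm) ennreal_le_iff) (rule integral_nonneg_AE[OF pos(2)])
qed

end

section \<open>The regret bounds\<close>

context weighted_tree
begin

lemma psi_eq:
  assumes q: "q \<in> prob_simplex G"
  shows "psi G L R (n + 1) q = rate n * ((\<Sum>j=1..L. R j) - ent q)"
proof -
  have "(\<Sum>j=1..L. R j * (\<Sum>v\<in>level G j. mass G q v - sqrt (mass G q v)))
      = (\<Sum>j=1..L. R j - R j * (\<Sum>v\<in>level G j. sqrt (mass G q v)))"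
    using q by (intro sum.cong refl) (simp add: sum_subtractf sum_level_simplex right_diff_distrib)
  also have "\<dots> = (\<Sum>j=1..L. R j) - ent q"
    unfolding ent_def sum_weight_nonroot by (rule sum_subtractf)
  finally show ?thesis by (simp only: psi_def rate_def)
qed

definition cum_estimate :: "'v strategy \<Rightarrow> nat \<Rightarrow> 'v history \<Rightarrow> 'v \<Rightarrow> real" where
  "cum_estimate p n h a = (\<Sum>s<n. loss_estimate G (p s (restrict h {0..<s})) (h s) a)"

lemma ftrl_minimizer:
  assumes "ftrl G L R p" and h: "h \<in> space (history_space G R n)"
  shows "minimizer (cum_estimate p n h) (rate n) (p n h)"
proof -
  let ?\<phi> = "\<lambda>q. (\<Sum>a\<in>leaves G. cum_estimate p n h a * q a) + psi G L R (n + 1) q"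
  have "is_arg_min ?\<phi> (\<lambda>q. q \<in> prob_simplex G) (p n h)"
    using assms unfolding ftrl_def cum_estimate_def by blast
  moreover have "?\<phi> q = obj (cum_estimate p n h) (rate n) q + rate n * (\<Sum>j=1..L. R j)"
    if "q \<in> prob_simplex G" for q
    unfolding psi_eq[OF that] by (simp add: obj_def pairing_def right_diff_distrib)
  ultimately show ?thesis
    by (auto simp: is_arg_min_def minimizer_def not_less)
qed

lemma restrict_in_history_space:
  "h \<in> space (history_space G R n) \<Longrightarrow> s \<le> n \<Longrightarrow> restrict h {0..<s} \<in> space (history_space G R s)"
  by (auto simp: history_space_def space_PiM PiE_iff)

text \<open>Induction over rounds: the cumulative estimates are built from earlier plays, and the
  current play is a Hoelder function of them. The rate is deterministic, so
  \<open>minimizer_hoelder\<close> compares any two histories.\<close>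

lemma measurable_ftrl:
  assumes p: "ftrl G L R p"
  shows "a \<in> leaves G \<Longrightarrow> (\<lambda>h. p n h a) \<in> borel_measurable (history_space G R n)"
proof (induction n arbitrary: a rule: less_induct)
  case (less n)
  show ?case
  proof (rule borel_measurable_of_coordinates[OF finite_leaves])
    fix b assume "b \<in> leaves G"
    show "(\<lambda>h. cum_estimate p n h b) \<in> borel_measurable (history_space G R n)"
      unfolding cum_estimate_def
    proof (rule borel_measurable_sum)
      fix s assume "s \<in> {..<n}"
      then have s: "s < n" by simp
      show "(\<lambda>h. loss_estimate G (p s (restrict h {0..<s})) (h s) b) \<in> borel_measurable (history_space G R n)"
      proof -
        have "(\<lambda>x. loss_estimate G (p s (fst x)) (snd x) b) \<in> borel_measurable (history_space G R s \<Otimes>\<^sub>M round_space G R)"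
          by (rule measurable_loss_estimate) (rule less.IH[OF s])
        from measurable_compose[OF measurable_past[OF s] this] show ?thesis by simp
      qed
    qed
  next
    fix h h' assume h: "h \<in> space (history_space G R n)" "h' \<in> space (history_space G R n)"
    show "(p n h a - p n h' a)\<^sup>2 \<le> 4 / (rate n * R L) * (\<Sum>b\<in>leaves G. \<bar>cum_estimate p n h b - cum_estimate p n h' b\<bar>)"
      using minimizer_hoelder[OF ftrl_minimizer[OF p h(2)] ftrl_minimizer[OF p h(1)] _ less.prems] rate_ge_10[of n]
      by (simp add: abs_minus_commute)
  qed
qed

text \<open>The indicator removes all nodes off the played path, and on that path the losses are
  observed.\<close>

lemma loss_estimate_observed:
  assumes obs: "observe G r = observe G r'" and q: "\<And>a. a \<in> leaves G \<Longrightarrow> q a = q' a"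
  shows "loss_estimate G q r b = loss_estimate G q' r' b"
  unfolding loss_estimate_def
proof (rule sum.cong[OF refl])
  fix v assume "v \<in> path G b"
  then have v: "v \<in> nonroot G" by (simp add: path_def)
  have act: "snd r = snd r'" using obs by (simp add: observe_def)
  have eq: "restrict (fst r) (path G (snd r)) = restrict (fst r') (path G (snd r'))"
    using obs unfolding observe_def prod.inject by (rule conjunct1)
  have "fst r v = fst r' v" if "ancestor G v (snd r')"
    using fun_cong[OF eq, of v] v that act by (simp add: path_def)
  moreover have "mass G q v = mass G q' v"
    unfolding mass_def by (intro sum.cong refl q) (simp add: leaves_below_def)
  ultimately show "of_bool (ancestor G v (snd r)) * (fst r v / mass G q v)
      = of_bool (ancestor G v (snd r')) * (fst r' v / mass G q' v)"
    using act by (cases "ancestor G v (snd r')") simp_all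
qed

text \<open>Equal observations and, by induction, equal earlier plays give equal cumulative
  estimates; then uniqueness of the minimizer applies.\<close>

lemma ftrl_observed:
  assumes p: "ftrl G L R p"
  shows "h \<in> space (history_space G R n) \<Longrightarrow> h' \<in> space (history_space G R n) \<Longrightarrow>
    (\<And>s. s < n \<Longrightarrow> observe G (h s) = observe G (h' s)) \<Longrightarrow> a \<in> leaves G \<Longrightarrow> p n h a = p n h' a"
proof (induction n arbitrary: h h' a rule: less_induct)
  case (less n)
  have "cum_estimate p n h b = cum_estimate p n h' b" for b
    unfolding cum_estimate_def
  proof (rule sum.cong[OF refl], rule loss_estimate_observed)
    fix s assume "s \<in> {..<n}"
    then have s: "s < n" by simp
    show "observe G (h s) = observe G (h' s)" by (rule less.prems(3)[OF s])
    fix a assume a: "a \<in> leaves G"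
    show "p s (restrict h {0..<s}) a = p s (restrict h' {0..<s}) a"
      by (rule less.IH[OF s restrict_in_history_space restrict_in_history_space _ a])
         (use s less.prems(1-3) in auto)
  qed
  then have "(p n h' a - p n h a)\<^sup>2 \<le> 0"
    using minimizer_hoelder[OF ftrl_minimizer[OF p less.prems(1)] ftrl_minimizer[OF p less.prems(2)] _ less.prems(4)]
      rate_ge_10[of n] by simp
  then show ?case by simp
qed

text \<open>This makes the law of the game well defined for the strategy and allows the gap
  hypothesis, which speaks of learners, to be applied to it.\<close>

lemma ftrl_learner:
  assumes p: "ftrl G L R p"
  shows "learner G R p"
  unfolding learner_def
  using minimizer_simplex[OF ftrl_minimizer[OF p]] measurable_ftrl[OF p] ftrl_observed[OF p] by blast

end

section \<open>Expected regret of the minimizing strategy\<close>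

locale ftrl_game = weighted_tree G L R for G :: "'v rtree" and L R +
  fixes env :: "'v env" and p :: "'v strategy"
  assumes environment: "environment G R env" and ftrl: "ftrl G L R p"
begin

sublocale tree_game G L R env p
  by unfold_locales (rule environment, rule ftrl_learner[OF ftrl])

lemma strategy_pos: "h \<in> space (history_space G R n) \<Longrightarrow> a \<in> leaves G \<Longrightarrow> 0 < p n h a"
  by (rule minimizer_pos[OF ftrl_minimizer[OF ftrl]]) (use rate_ge_10[of n] in simp_all)

lemma mass_strategy_pos: "h \<in> space (history_space G R n) \<Longrightarrow> v \<in> nonroot G \<Longrightarrow> 0 < mass G (p n h) v"
  by (rule mass_pos[OF strategy_pos]) (simp_all add: nonroot_def)

abbreviation played :: "nat \<Rightarrow> 'v history \<Rightarrow> 'v \<Rightarrow> real" where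
  "played t h \<equiv> p t (restrict h {0..<t})"

lemma played_simplex: "h \<in> space (play G R env p T) \<Longrightarrow> t < T \<Longrightarrow> played t h \<in> prob_simplex G"
  by (rule strategy_simplex[OF past_in_space(1)])

lemma pathwise:
  assumes T: "1 \<le> T" and h: "h \<in> space (play G R env p T)" and u: "u \<in> leaves G"
  shows "(\<Sum>t<T. action_loss G (fst (h t)) (snd (h t))) - (\<Sum>t<T. loss_estimate G (played t h) (h t) u)
     \<le> (\<Sum>t<T. stab (rate t) (played t h) (h t) + rate_step t * ent_gap (played t h))"
proof -
  obtain n where n: "T = Suc n" using T by (cases T) auto
  have "(\<Sum>t\<le>n. action_loss G (fst (h t)) (snd (h t))) - (\<Sum>t\<le>n. loss_estimate G (played t h) (h t) u)
     \<le> (\<Sum>t\<le>n. stab (rate t) (played t h) (h t)) + rate 0 * ent_gap (played 0 h)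
       + (\<Sum>t=1..n. (rate t - rate (t - 1)) * ent_gap (played t h))"
  proof (rule ftrl_pathwise[OF _ rate_ge_10 _ u])
    fix t assume t: "t \<le> n"
    then have tT: "t < T" using n by simp
    show "bounded_loss (fst (h t)) \<and> snd (h t) \<in> leaves G"
      using space_round_space past_in_space(2)[OF h tT] by blast
    have "cum_estimate p t (restrict h {0..<t}) = (\<lambda>a. \<Sum>s<t. loss_estimate G (played s h) (h s) a)"
      by (intro ext) (auto simp: cum_estimate_def min_def intro!: sum.cong)
    then show "minimizer (\<lambda>a. \<Sum>s<t. loss_estimate G (played s h) (h s) a) (rate t) (played t h)"
      using ftrl_minimizer[OF ftrl past_in_space(1)[OF h tT]] by simp
  qed
  moreover have "(\<Sum>t\<le>n. rate_step t * ent_gap (played t h))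
      = rate 0 * ent_gap (played 0 h) + (\<Sum>t=1..n. (rate t - rate (t - 1)) * ent_gap (played t h))"
    unfolding atMost_atLeast0 by (subst sum.atLeast_Suc_atMost) (auto simp: rate_step_def intro!: sum.cong)
  ultimately show ?thesis
    unfolding n lessThan_Suc_atMost sum.distrib by linarith
qed

lemma action_loss_bounds:
  assumes l: "bounded_loss l"
  shows "0 \<le> action_loss G l a" "action_loss G l a \<le> (\<Sum>v\<in>nonroot G. weight v)"
proof -
  have v: "0 \<le> l v" "l v \<le> weight v" if "v \<in> nonroot G" for v
    using l that by (auto simp: bounded_loss_def)
  show "0 \<le> action_loss G l a"
    unfolding action_loss_def using v by (intro sum_nonneg) (simp add: path_def)
  have "action_loss G l a \<le> (\<Sum>v\<in>path G a. weight v)"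
    unfolding action_loss_def using v by (intro sum_mono) (simp add: path_def)
  also have "\<dots> \<le> (\<Sum>v\<in>nonroot G. weight v)"
    using weight_pos by (intro sum_mono2) (auto simp: path_def less_imp_le)
  finally show "action_loss G l a \<le> (\<Sum>v\<in>nonroot G. weight v)" .
qed

lemma loss_estimate_nonneg:
  assumes "bounded_loss (fst r)" "q \<in> prob_simplex G"
  shows "0 \<le> loss_estimate G q r a"
  unfolding loss_estimate_def using assms mass_nonneg
  by (intro sum_nonneg mult_nonneg_nonneg divide_nonneg_nonneg) (auto simp: bounded_loss_def path_def)

lemma measurable_node_mass:
  "(\<lambda>x. mass G (p t (fst x)) v) \<in> borel_measurable (history_space G R t \<Otimes>\<^sub>M round_space G R)"
  by (rule measurable_compose[OF measurable_fst], rule measurable_past_mass, rule measurable_strategy)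

lemma measurable_ent_gap:
  "(\<lambda>x. ent_gap (p t (fst x))) \<in> borel_measurable (history_space G R t \<Otimes>\<^sub>M round_space G R)"
proof -
  note [measurable] = measurable_node_mass
  show ?thesis unfolding ent_gap_def ent_def by measurable
qed

lemma measurable_spread:
  "(\<lambda>x. spread (p t (fst x))) \<in> borel_measurable (history_space G R t \<Otimes>\<^sub>M round_space G R)"
proof -
  note [measurable] = measurable_node_mass
  show ?thesis unfolding spread_def by measurable
qed

lemma sum_strategy_const:
  "h \<in> space (history_space G R t) \<Longrightarrow> (\<Sum>a\<in>leaves G. p t h a * c) = c"
  by (simp add: simplex_sum strategy_simplex flip: sum_distrib_right)

lemma ent_gap_lower: "q \<in> prob_simplex G \<Longrightarrow> - (\<Sum>j=1..L. R j) \<le> ent_gap q"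
  unfolding ent_gap_def ent_def using weight_pos mass_nonneg
  by (simp add: sum_nonneg less_imp_le)

lemma integrable_ent_gap:
  assumes t: "t < T"
  shows "integrable (play G R env p T) (\<lambda>h. ent_gap (played t h))"
proof (rule integrable_play_bounded[where g = "\<lambda>h r. ent_gap (p t h)" and B = "adv_width + \<bar>\<Sum>j=1..L. R j\<bar>", OF t])
  fix h assume h: "h \<in> space (history_space G R t)"
  show "\<bar>ent_gap (p t h)\<bar> \<le> adv_width + \<bar>\<Sum>j=1..L. R j\<bar>"
    using ent_gap_le[OF strategy_simplex[OF h]] ent_gap_lower[OF strategy_simplex[OF h]] adv_width_nonneg
    by linarith
qed (use measurable_ent_gap in \<open>simp add: case_prod_beta'\<close>)

lemma integrable_action_loss:
  assumes t: "t < T"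
  shows "integrable (play G R env p T) (\<lambda>h. action_loss G (fst (h t)) (snd (h t)))" (is ?played)
    and "integrable (play G R env p T) (\<lambda>h. action_loss G (fst (h t)) a)" (is ?fixed)
proof -
  have bound: "\<bar>action_loss G (fst r) b\<bar> \<le> (\<Sum>v\<in>nonroot G. weight v)" if "r \<in> space (round_space G R)" for r b
    using action_loss_bounds[OF space_round_space(1)[OF that]] by simp
  show ?played
    by (rule integrable_play_bounded[where g = "\<lambda>h r. action_loss G (fst r) (snd r)", OF t _ bound])
       (simp_all only: case_prod_beta' measurable_action_loss)
  show ?fixed
    by (rule integrable_play_bounded[where g = "\<lambda>h r. action_loss G (fst r) a", OF t _ bound])
       (simp_all only: case_prod_beta' measurable_action_loss)
qed

text \<open>An upper bound is all that is required, because the estimate at the comparator enters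
  the pathwise inequality with a minus sign.\<close>

lemma expected_loss_estimate:
  assumes t: "t < T"
  shows "integrable (play G R env p T) (\<lambda>h. loss_estimate G (played t h) (h t) u)" (is ?int)
    and "(\<integral>h. loss_estimate G (played t h) (h t) u \<partial>play G R env p T)
      \<le> (\<integral>h. action_loss G (fst (h t)) u \<partial>play G R env p T)" (is ?le)
proof -
  let ?g = "\<lambda>h r. loss_estimate G (p t h) r u" and ?g' = "\<lambda>h r. action_loss G (fst r) u"
  have le: "(\<Sum>a\<in>leaves G. p t h a * ?g h (l, a)) \<le> (\<Sum>a\<in>leaves G. p t h a * ?g' h (l, a))"
    if h: "h \<in> space (history_space G R t)" for h l
    using loss_estimate_unbiased[OF mass_strategy_pos[OF h]] by (simp add: sum_strategy_const[OF h])
  have meas: "case_prod ?g \<in> borel_measurable (history_space G R t \<Otimes>\<^sub>M round_space G R)"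
    "case_prod ?g' \<in> borel_measurable (history_space G R t \<Otimes>\<^sub>M round_space G R)"
    unfolding case_prod_beta'
    by (rule measurable_loss_estimate, rule measurable_strategy, assumption) (rule measurable_action_loss)
  have nonneg: "0 \<le> ?g h r" if "h \<in> space (history_space G R t)" "r \<in> space (round_space G R)" for h r
    using that by (intro loss_estimate_nonneg space_round_space(1) strategy_simplex)
  have bounds: "0 \<le> ?g' h r \<and> ?g' h r \<le> (\<Sum>v\<in>nonroot G. weight v)"
    if "h \<in> space (history_space G R t)" "r \<in> space (round_space G R)" for h r
    using that by (intro conjI action_loss_bounds space_round_space(1))
  show ?int by (rule expectation_mono(1)[OF t meas nonneg bounds le])
  show ?le by (rule expectation_mono(3)[OF t meas nonneg bounds le])
qed

lemma expected_stab:
  assumes t: "t < T"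
  shows "integrable (play G R env p T) (\<lambda>h. stab (rate t) (played t h) (h t))" (is ?int)
    and "integrable (play G R env p T) (\<lambda>h. 5 / 2 / rate t * spread (played t h))" (is ?int')
    and "(\<integral>h. stab (rate t) (played t h) (h t) \<partial>play G R env p T)
      \<le> (\<integral>h. 5 / 2 / rate t * spread (played t h) \<partial>play G R env p T)" (is ?le)
proof -
  let ?g = "\<lambda>h r. stab (rate t) (p t h) r" and ?g' = "\<lambda>h r. 5 / 2 / rate t * spread (p t h)"
  have b: "0 < rate t" using rate_ge_10[of t] by simp
  have le: "(\<Sum>a\<in>leaves G. p t h a * ?g h (l, a)) \<le> (\<Sum>a\<in>leaves G. p t h a * ?g' h (l, a))"
    if h: "h \<in> space (history_space G R t)" and l: "bounded_loss l" for h l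
    unfolding sum_strategy_const[OF h]
    by (rule stab_expectation[OF strategy_simplex[OF h] l b mass_strategy_pos[OF h]])
  have meas: "case_prod ?g \<in> borel_measurable (history_space G R t \<Otimes>\<^sub>M round_space G R)"
    "case_prod ?g' \<in> borel_measurable (history_space G R t \<Otimes>\<^sub>M round_space G R)"
    unfolding case_prod_beta'
    by (rule measurable_stab, rule measurable_strategy, assumption)
       (rule borel_measurable_times[OF measurable_const measurable_spread], simp)
  have nonneg: "0 \<le> ?g h r" if "h \<in> space (history_space G R t)" "r \<in> space (round_space G R)" for h r
    using that b by (intro stab_nonneg strategy_simplex)
  have bounds: "0 \<le> ?g' h r \<and> ?g' h r \<le> 5 / 2 / rate t * adv_width"
    if "h \<in> space (history_space G R t)" "r \<in> space (round_space G R)" for h r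
    using that b spread_nonneg spread_le by (simp add: strategy_simplex divide_right_mono)
  show ?int by (rule expectation_mono(1)[OF t meas nonneg bounds le])
  show ?le by (rule expectation_mono(3)[OF t meas nonneg bounds le])
  show ?int' by (rule expectation_mono(2)[OF t meas nonneg bounds le])
qed

lemma integrable_round_bound: "t < T \<Longrightarrow> integrable (play G R env p T) (\<lambda>h. round_bound t (played t h))"
  unfolding round_bound_def
  by (intro Bochner_Integration.integrable_add expected_stab(2) integrable_mult_right integrable_ent_gap)

lemma integral_round_bound:
  assumes t: "t < T"
  shows "(\<integral>h. round_bound t (played t h) \<partial>play G R env p T)
    = (\<integral>h. 5 / 2 / rate t * spread (played t h) \<partial>play G R env p T)
      + rate_step t * (\<integral>h. ent_gap (played t h) \<partial>play G R env p T)"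
  unfolding round_bound_def
  by (subst Bochner_Integration.integral_add[OF expected_stab(2)[OF t]])
     (auto intro: integrable_mult_right integrable_ent_gap[OF t])

lemma regret_le_round_bounds:
  assumes T: "1 \<le> T"
  shows "regret G R env p T \<le> (\<integral>h. (\<Sum>t<T. round_bound t (played t h)) \<partial>play G R env p T)"
proof -
  let ?M = "play G R env p T"
  note [simp] = integrable_action_loss expected_loss_estimate(1) expected_stab(1) integrable_ent_gap integrable_round_bound
  let ?E = "\<lambda>a. \<integral>h. (\<Sum>t<T. action_loss G (fst (h t)) a) \<partial>?M"
  \<comment> \<open>The minimum in the regret is taken over expectations, so the comparator
    \<open>u\<close> is a fixed leaf and the pathwise bound can simply be integrated.\<close>
  have "Min (?E ` leaves G) \<in> ?E ` leaves G"
    using leaves_nonempty by (intro Min_in) auto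
  then obtain u where u: "u \<in> leaves G" "Min (?E ` leaves G) = ?E u" by auto
  have "(\<integral>h. (\<Sum>t<T. loss_estimate G (played t h) (h t) u) \<partial>?M) \<le> ?E u"
  proof -
    have "(\<Sum>t<T. \<integral>h. loss_estimate G (played t h) (h t) u \<partial>?M)
        \<le> (\<Sum>t<T. \<integral>h. action_loss G (fst (h t)) u \<partial>?M)"
      by (intro sum_mono expected_loss_estimate(2)) simp
    then show ?thesis by simp
  qed
  then have "regret G R env p T \<le> (\<integral>h. (\<Sum>t<T. action_loss G (fst (h t)) (snd (h t))) \<partial>?M)
      - (\<integral>h. (\<Sum>t<T. loss_estimate G (played t h) (h t) u) \<partial>?M)"
    unfolding regret_def u(2) by simp
  also have "\<dots> = (\<integral>h. (\<Sum>t<T. action_loss G (fst (h t)) (snd (h t))) - (\<Sum>t<T. loss_estimate G (played t h) (h t) u) \<partial>?M)"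
    by (intro Bochner_Integration.integral_diff[symmetric] Bochner_Integration.integrable_sum) simp_all
  also have "\<dots> \<le> (\<integral>h. (\<Sum>t<T. stab (rate t) (played t h) (h t) + rate_step t * ent_gap (played t h)) \<partial>?M)"
    by (intro integral_mono pathwise T u(1) Bochner_Integration.integrable_sum Bochner_Integration.integrable_diff) simp_all
  also have "\<dots> = (\<Sum>t<T. (\<integral>h. stab (rate t) (played t h) (h t) \<partial>?M) + rate_step t * (\<integral>h. ent_gap (played t h) \<partial>?M))"
    by simp
  also have "\<dots> \<le> (\<Sum>t<T. (\<integral>h. 5 / 2 / rate t * spread (played t h) \<partial>?M) + rate_step t * (\<integral>h. ent_gap (played t h) \<partial>?M))"
    by (intro sum_mono add_right_mono expected_stab(3)) simp
  also have "\<dots> = (\<Sum>t<T. \<integral>h. round_bound t (played t h) \<partial>?M)"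
    by (intro sum.cong refl integral_round_bound[symmetric]) simp
  also have "\<dots> = (\<integral>h. (\<Sum>t<T. round_bound t (played t h)) \<partial>?M)"
    by (rule Bochner_Integration.integral_sum[symmetric]) simp
  finally show ?thesis .
qed

lemma sqrt_K_eff: "sqrt (K_eff G L R) = adv_width"
  using adv_width_nonneg by (simp add: K_eff_def adv_width_def)

lemma regret_adversarial:
  assumes T: "1 \<le> T"
  shows "regret G R env p T \<le> 15 * sqrt (K_eff G L R) + 4 * sqrt (5 * K_eff G L R * real T)"
proof -
  interpret prob_space "play G R env p T" by (rule prob_space_play)
  have "(\<integral>h. (\<Sum>t<T. round_bound t (played t h)) \<partial>play G R env p T)
      \<le> 15 * adv_width + 4 * (sqrt (5 * real T) * adv_width)"
    by (intro integral_le_const Bochner_Integration.integrable_sum AE_I2 adversarial_bound T)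
       (auto intro: integrable_round_bound played_simplex)
  with regret_le_round_bounds[OF T] show ?thesis
    by (simp add: sqrt_K_eff real_sqrt_mult mult_ac)
qed

text \<open>Given the past, the expected gap of the played action is \<open>pairing\<close> of the
  gaps with the current distribution. This links the gap hypothesis to the terms of
  \<open>stochastic_bound\<close>.\<close>

lemma expected_gap:
  assumes t: "t < T" and \<Delta>: "\<And>a. a \<in> leaves G \<Longrightarrow> 0 \<le> \<Delta> a"
  shows "integrable (play G R env p T) (\<lambda>h. \<Delta> (snd (h t)))" (is ?int')
    and "integrable (play G R env p T) (\<lambda>h. pairing \<Delta> (played t h))" (is ?int)
    and "(\<integral>h. pairing \<Delta> (played t h) \<partial>play G R env p T) \<le> (\<integral>h. \<Delta> (snd (h t)) \<partial>play G R env p T)" (is ?le)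
proof -
  let ?g = "\<lambda>h r. pairing \<Delta> (p t h)" and ?g' = "\<lambda>h r. \<Delta> (snd r)"
  have le: "(\<Sum>a\<in>leaves G. p t h a * ?g h (l, a)) \<le> (\<Sum>a\<in>leaves G. p t h a * ?g' h (l, a))"
    if h: "h \<in> space (history_space G R t)" for h l
    using simplex_sum[OF strategy_simplex[OF h]]
    by (simp add: pairing_def mult.commute flip: sum_distrib_right sum_distrib_left)
  have meas: "case_prod ?g \<in> borel_measurable (history_space G R t \<Otimes>\<^sub>M round_space G R)"
    "case_prod ?g' \<in> borel_measurable (history_space G R t \<Otimes>\<^sub>M round_space G R)"
    using measurable_round[where F = "\<lambda>h l A. \<Delta> A" and H = "history_space G R t"]
    unfolding pairing_def case_prod_beta'
    by (auto intro!: borel_measurable_sum borel_measurable_times measurable_compose[OF measurable_fst] measurable_strategy)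
  have nonneg: "0 \<le> ?g h r" if "h \<in> space (history_space G R t)" "r \<in> space (round_space G R)" for h r
    unfolding pairing_def using that \<Delta> simplex_nonneg[OF strategy_simplex] by (intro sum_nonneg mult_nonneg_nonneg)
  have bounds: "0 \<le> ?g' h r \<and> ?g' h r \<le> (\<Sum>a\<in>leaves G. \<Delta> a)"
    if "h \<in> space (history_space G R t)" "r \<in> space (round_space G R)" for h r
    using \<Delta> space_round_space(2)[OF that(2)] by (auto intro: member_le_sum)
  show ?int by (rule expectation_mono(1)[OF t meas nonneg bounds le])
  show ?le by (rule expectation_mono(3)[OF t meas nonneg bounds le])
  show ?int' by (rule expectation_mono(2)[OF t meas nonneg bounds le])
qed

lemma regret_stochastic:
  assumes T: "1 \<le> T" and \<Delta>: "\<And>a. a \<in> leaves G \<Longrightarrow> 0 \<le> \<Delta> a"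
    and best: "card {a \<in> leaves G. \<Delta> a = 0} \<le> 1"
    and self_bound: "(\<integral>h. (\<Sum>t<T. \<Delta> (snd (h t))) \<partial>play G R env p T) \<le> regret G R env p T"
  shows "regret G R env p T \<le> 30 * sqrt (K_eff G L R) + 20 * K_eff_sto G L R \<Delta> * ln (exp 1 * real T)"
proof -
  let ?M = "play G R env p T"
  interpret prob_space ?M by (rule prob_space_play)
  interpret gapped_tree G L R \<Delta> by unfold_locales (rule \<Delta>, assumption, rule best)
  let ?Q = "\<lambda>h. \<Sum>t<T. round_bound t (played t h)" and ?D = "\<lambda>h. \<Sum>t<T. pairing \<Delta> (played t h)"
  have int: "integrable ?M ?Q"
    by (intro Bochner_Integration.integrable_sum integrable_round_bound) simp
  have gap: "integrable ?M (\<lambda>h. \<Delta> (snd (h t)))" "integrable ?M (\<lambda>h. pairing \<Delta> (played t h))"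
    "(\<integral>h. pairing \<Delta> (played t h) \<partial>?M) \<le> (\<integral>h. \<Delta> (snd (h t)) \<partial>?M)" if "t < T" for t
    using expected_gap[of t T \<Delta>] that \<Delta> by blast+
  then have intD: "integrable ?M ?D"
    by (intro Bochner_Integration.integrable_sum) simp
  have "(\<integral>h. ?D h \<partial>?M) \<le> (\<integral>h. (\<Sum>t<T. \<Delta> (snd (h t))) \<partial>?M)"
  proof -
    have "(\<Sum>t<T. \<integral>h. pairing \<Delta> (played t h) \<partial>?M) \<le> (\<Sum>t<T. \<integral>h. \<Delta> (snd (h t)) \<partial>?M)"
      using gap(3) by (intro sum_mono) simp
    then show ?thesis using gap(1,2) by simp
  qed
  then have "regret G R env p T \<le> 2 * (\<integral>h. ?Q h \<partial>?M) - (\<integral>h. ?D h \<partial>?M)"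
    using self_bound regret_le_round_bounds[OF T] by linarith
  also have "\<dots> = (\<integral>h. 2 * ?Q h - ?D h \<partial>?M)"
    using int intD by (subst Bochner_Integration.integral_diff) simp_all
  also have "\<dots> \<le> 30 * adv_width + 20 * sto_width\<^sup>2 * ln (exp 1 * real T)"
    using int intD by (intro integral_le_const AE_I2 stochastic_bound T played_simplex) simp_all
  finally show ?thesis
    by (simp add: sqrt_K_eff K_eff_sto_def sto_width_def)
qed

end

theorem theorem2:
  fixes G :: "'v rtree" and L T :: nat and R :: "nat \<Rightarrow> real"
    and env :: "'v env" and p :: "'v strategy"
  assumes tree: "uniform_tree G L"
    and R: "\<And>j. 1 \<le> j \<Longrightarrow> j \<le> L \<Longrightarrow> 0 < R j \<and> R j \<le> 1"
    and env: "environment G R env"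
    and ftrl: "ftrl G L R p"
    and T: "1 \<le> T"
  shows "regret G R env p T \<le> 15 * sqrt (K_eff G L R) + 4 * sqrt (5 * K_eff G L R * real T) \<and>
         (\<forall>\<Delta> :: 'v \<Rightarrow> real.
            (\<forall>a\<in>leaves G. 0 \<le> \<Delta> a) \<and>
            card {a \<in> leaves G. \<Delta> a = 0} \<le> 1 \<and>
            (\<forall>q. learner G R q \<longrightarrow>
               regret G R env q T \<ge> (\<integral>h. (\<Sum>t<T. \<Delta> (snd (h t))) \<partial>play G R env q T)) \<longrightarrow>
            regret G R env p T \<le>
              30 * sqrt (K_eff G L R) + 20 * K_eff_sto G L R \<Delta> * ln (exp 1 * real T))"
proof -
  interpret ftrl_game G L R env p
    by unfold_locales (use tree R env ftrl in auto)
  show ?thesis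
    \<comment> \<open>The fact \<open>learner\<close> specializes the gap hypothesis to
      \<open>q = p\<close>.\<close>
    using regret_adversarial[OF T] regret_stochastic[OF T] learner by blast
qed

end
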